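(* Let $G$ be a topological group, let $\mathcal{F}$ be any set of subgroups of $G$, and let $\kappa$ be an infinite cardinal. Then $E_\mathcal{F}^\kappa G$ is a final object in the category whose objects are all topological $G$-spaces covered by $\kappa$-many $\mathcal{F}$-tubes and whose morphisms are $G$-homotopy classes of $G$-maps.
   Context: All $G$-spaces are right $G$-spaces with continuous action; a $G$-map is a continuous $G$-equivariant function; a $G$-homotopy is a homotopy through $G$-maps, i.e. a $G$-map $X\times[-1,1]\to Y$ with trivial action on $[-1,1]$. For a subgroup $H\le G$, $H\backslash G$ is the right $G$-space of cosets $Hg$ with the quotient topology; $\mathcal{F}\backslash G:=\bigsqcup_{H\in\mathcal{F}}H\backslash G$ with the disjoint-union topology. For a topological space $(A,\mathcal{T})$, the indiscrete cone $c(A,\mathcal{T})$ is the set $A\sqcup\{0\}$ with topology $\mathcal{T}\cup\{A\sqcup\{0\}\}$; if $A$ is a $G$-space, $G$ acts on it fixing $0$. For a set $I$ with $\mathrm{card}(I)=\kappa$, $E_\mathcal{F}^\kappa G:=(c(\mathcal{F}\backslash G))^I-\{0\}^I$ (subspace of the product topology, diagonal $G$-action). For a right $H$-space $S$, $S\times_H G:=(S\times G)/((sh,g)\sim(s,hg))$. An open $G$-subset $T\subseteq X$ is an $\mathcal{F}$-tube if it is $G$-homeomorphic to $S\times_H G$ for some $H\in\mathcal{F}$ and $H$-space $S$. $X$ is covered by $\kappa$-many $\mathcal{F}$-tubes if $X=\bigcup_{i\in I}T_i$ with each $T_i$ an $\mathcal{F}$-tube and $\mathrm{card}(I)=\ka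ppa$.
   Formalization: As stated E need not be an object (F empty; all lines in the plane with κ countable). That E is an object, hence final, is proved if some nonempty F' ⊆ F with at most κ members has each H in F subconjugate to a member; unique homotopy classes into E hold for any F. *)

theory Defs
  imports "HOL-Analysis.Analysis" "HOL-Algebra.Coset"
begin

definition topological_group :: "('g, 'm) monoid_scheme \<Rightarrow> 'g topology \<Rightarrow> bool" where
  "topological_group G \<tau> \<longleftrightarrow>
     group G \<and> topspace \<tau> = carrier G \<and>
     continuous_map (prod_topology \<tau> \<tau>) \<tau> (\<lambda>(x, y). x \<otimes>\<^bsub>G\<^esub> y) \<and>
     continuous_map \<tau> \<tau> (\<lambda>x. inv\<^bsub>G\<^esub> x)"

text \<open>A right \<open>G\<close>-space is a topology \<open>X\<close> together with a continuous right action \<open>a\<close>.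
  For a subgroup \<open>H\<close> of \<open>G\<close>, the \<open>H\<close>-spaces are obtained by taking \<open>G\<lparr>carrier := H\<rparr>\<close> with the
  subspace topology.\<close>

definition right_space ::
  "('g, 'm) monoid_scheme \<Rightarrow> 'g topology \<Rightarrow> 'x topology \<Rightarrow> ('x \<Rightarrow> 'g \<Rightarrow> 'x) \<Rightarrow> bool" where
  "right_space G \<tau> X a \<longleftrightarrow>
     continuous_map (prod_topology X \<tau>) X (\<lambda>(x, g). a x g) \<and>
     (\<forall>x\<in>topspace X. a x \<one>\<^bsub>G\<^esub> = x) \<and>
     (\<forall>x\<in>topspace X. \<forall>g\<in>carrier G. \<forall>h\<in>carrier G. a (a x g) h = a x (g \<otimes>\<^bsub>G\<^esub> h))"

definition equivariant ::
  "('g, 'm) monoid_scheme \<Rightarrow> 'x topology \<Rightarrow> ('x \<Rightarrow> 'g \<Rightarrow> 'x) \<Rightarrow> ('y \<Rightarrow> 'g \<Rightarrow> 'y) \<Rightarrow> ('x \<Rightarrow> 'y) \<Rightarrow> bool"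
where
  "equivariant G X a b f \<longleftrightarrow> (\<forall>x\<in>topspace X. \<forall>g\<in>carrier G. f (a x g) = b (f x) g)"

definition G_map ::
  "('g, 'm) monoid_scheme \<Rightarrow> 'x topology \<Rightarrow> ('x \<Rightarrow> 'g \<Rightarrow> 'x) \<Rightarrow>
   'y topology \<Rightarrow> ('y \<Rightarrow> 'g \<Rightarrow> 'y) \<Rightarrow> ('x \<Rightarrow> 'y) \<Rightarrow> bool" where
  "G_map G X a Y b f \<longleftrightarrow> continuous_map X Y f \<and> equivariant G X a b f"

definition G_homotopic ::
  "('g, 'm) monoid_scheme \<Rightarrow> 'x topology \<Rightarrow> ('x \<Rightarrow> 'g \<Rightarrow> 'x) \<Rightarrow>
   'y topology \<Rightarrow> ('y \<Rightarrow> 'g \<Rightarrow> 'y) \<Rightarrow> ('x \<Rightarrow> 'y) \<Rightarrow> ('x \<Rightarrow> 'y) \<Rightarrow> bool" where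
  "G_homotopic G X a Y b f f' \<longleftrightarrow>
     (\<exists>h. G_map G (prod_topology X (top_of_set {-1..1::real})) (\<lambda>(x, t) g. (a x g, t)) Y b h \<and>
          (\<forall>x\<in>topspace X. h (x, -1) = f x \<and> h (x, 1) = f' x))"

text \<open>Functions on \<open>X\<close> are normalised to be \<^term>\<open>undefined\<close> off \<open>topspace X\<close>, so that
  distinct elements of \<open>G_maps\<close> are distinct maps.\<close>

definition G_maps ::
  "('g, 'm) monoid_scheme \<Rightarrow> 'x topology \<Rightarrow> ('x \<Rightarrow> 'g \<Rightarrow> 'x) \<Rightarrow>
   'y topology \<Rightarrow> ('y \<Rightarrow> 'g \<Rightarrow> 'y) \<Rightarrow> ('x \<Rightarrow> 'y) set" where
  "G_maps G X a Y b = {f \<in> extensional (topspace X). G_map G X a Y b f}"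

definition G_homotopy_classes ::
  "('g, 'm) monoid_scheme \<Rightarrow> 'x topology \<Rightarrow> ('x \<Rightarrow> 'g \<Rightarrow> 'x) \<Rightarrow>
   'y topology \<Rightarrow> ('y \<Rightarrow> 'g \<Rightarrow> 'y) \<Rightarrow> ('x \<Rightarrow> 'y) set set" where
  "G_homotopy_classes G X a Y b =
     G_maps G X a Y b //
       {(f, f'). f \<in> G_maps G X a Y b \<and> f' \<in> G_maps G X a Y b \<and> G_homotopic G X a Y b f f'}"

definition quotient_topology :: "'a topology \<Rightarrow> ('a \<Rightarrow> 'b) \<Rightarrow> 'b topology" where
  "quotient_topology X q =
     topology (\<lambda>U. U \<subseteq> q ` topspace X \<and> openin X {x \<in> topspace X. q x \<in> U})"

lemma openin_quotient_topology:
  "openin (quotient_topology X q) U \<longleftrightarrow>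
     U \<subseteq> q ` topspace X \<and> openin X {x \<in> topspace X. q x \<in> U}"
proof -
  have "istopology (\<lambda>U. U \<subseteq> q ` topspace X \<and> openin X {x \<in> topspace X. q x \<in> U})"
    unfolding istopology_def
  proof (intro conjI allI impI)
    fix S T
    assume S: "S \<subseteq> q ` topspace X \<and> openin X {x \<in> topspace X. q x \<in> S}"
      and T: "T \<subseteq> q ` topspace X \<and> openin X {x \<in> topspace X. q x \<in> T}"
    show "S \<inter> T \<subseteq> q ` topspace X" using S by blast
    have "{x \<in> topspace X. q x \<in> S \<inter> T} = {x \<in> topspace X. q x \<in> S} \<inter> {x \<in> topspace X. q x \<in> T}"
      by blast
    then show "openin X {x \<in> topspace X. q x \<in> S \<inter> T}" using S T by auto
  next
    fix K
    assume K: "\<forall>S\<in>K. S \<subseteq> q ` topspace X \<and> openin X {x \<in> topspace X. q x \<in> S}"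
    then show "\<Union> K \<subseteq> q ` topspace X" by blast
    have "{x \<in> topspace X. q x \<in> \<Union> K} = (\<Union>S\<in>K. {x \<in> topspace X. q x \<in> S})" by blast
    then show "openin X {x \<in> topspace X. q x \<in> \<Union> K}" using K by auto
  qed
  then show ?thesis by (simp add: quotient_topology_def)
qed

lemma topspace_quotient_topology: "topspace (quotient_topology X q) = q ` topspace X"
proof
  show "topspace (quotient_topology X q) \<subseteq> q ` topspace X"
    by (metis openin_quotient_topology openin_topspace)
  have "{x \<in> topspace X. q x \<in> q ` topspace X} = topspace X" by blast
  then have "openin (quotient_topology X q) (q ` topspace X)"
    by (simp add: openin_quotient_topology)
  then show "q ` topspace X \<subseteq> topspace (quotient_topology X q)" by (rule openin_subset)
qed

lemma quotient_map_quotient_topology: "quotient_map X (quotient_topology X q) q"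
  by (auto simp: quotient_map_def topspace_quotient_topology openin_quotient_topology)

text \<open>\<open>H\G\<close>, and the disjoint union of the \<open>H\G\<close> for \<open>H \<in> F\<close>; a point of the latter is a pair
  consisting of \<open>H\<close> and a coset \<open>Hg\<close>.\<close>

definition coset_space :: "('g, 'm) monoid_scheme \<Rightarrow> 'g topology \<Rightarrow> 'g set \<Rightarrow> 'g set topology" where
  "coset_space G \<tau> H = quotient_topology \<tau> (\<lambda>g. H #>\<^bsub>G\<^esub> g)"

definition cosets_sum ::
  "('g, 'm) monoid_scheme \<Rightarrow> 'g topology \<Rightarrow> 'g set set \<Rightarrow> ('g set \<times> 'g set) topology" where
  "cosets_sum G \<tau> F = sum_topology (coset_space G \<tau>) F"

definition cosets_sum_act ::
  "('g, 'm) monoid_scheme \<Rightarrow> 'g set \<times> 'g set \<Rightarrow> 'g \<Rightarrow> 'g set \<times> 'g set" where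
  "cosets_sum_act G = (\<lambda>(H, C) g. (H, C #>\<^bsub>G\<^esub> g))"

text \<open>The indiscrete cone, with cone point \<^term>\<open>None\<close>.\<close>

definition indiscrete_cone :: "'a topology \<Rightarrow> 'a option topology" where
  "indiscrete_cone A =
     topology (\<lambda>U. (\<exists>V. openin A V \<and> U = Some ` V) \<or> U = insert None (Some ` topspace A))"

definition cone_act :: "('a \<Rightarrow> 'g \<Rightarrow> 'a) \<Rightarrow> 'a option \<Rightarrow> 'g \<Rightarrow> 'a option" where
  "cone_act a x g = map_option (\<lambda>y. a y g) x"

lemma openin_indiscrete_cone:
  "openin (indiscrete_cone A) U \<longleftrightarrow>
     (\<exists>V. openin A V \<and> U = Some ` V) \<or> U = insert None (Some ` topspace A)"
proof -
  let ?P = "\<lambda>U. (\<exists>V. openin A V \<and> U = Some ` V) \<or> U = insert None (Some ` topspace A)"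
  have sub: "U \<subseteq> insert None (Some ` topspace A)" if "?P U" for U
    using that openin_subset[of A] by blast
  have "istopology ?P"
    unfolding istopology_def
  proof (intro conjI allI impI)
    fix S T assume S: "?P S" and T: "?P T"
    consider "S = insert None (Some ` topspace A)" | "T = insert None (Some ` topspace A)"
      | V W where "openin A V" "S = Some ` V" "openin A W" "T = Some ` W"
      using S T by blast
    then show "?P (S \<inter> T)"
    proof cases
      case 1
      then have "S \<inter> T = T" using sub[OF T] by blast
      then show ?thesis using T by simp
    next
      case 2
      then have "S \<inter> T = S" using sub[OF S] by blast
      then show ?thesis using S by simp
    next
      case 3
      then have "S \<inter> T = Some ` (V \<inter> W)" by blast
      then show ?thesis using 3 by blast
    qed
  next
    fix K assume K: "\<forall>S\<in>K. ?P S"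
    show "?P (\<Union> K)"
    proof (cases "insert None (Some ` topspace A) \<in> K")
      case True
      then have "\<Union> K = insert None (Some ` topspace A)" using K sub by blast
      then show ?thesis by blast
    next
      case False
      then have ex: "\<exists>V. openin A V \<and> S = Some ` V" if "S \<in> K" for S
        using K that by metis
      define v where "v S = (SOME V. openin A V \<and> S = Some ` V)" for S
      have v: "openin A (v S)" "S = Some ` v S" if "S \<in> K" for S
        using someI_ex[OF ex[OF that]] by (auto simp: v_def)
      have "openin A (\<Union>S\<in>K. v S)" using v(1) by (intro openin_Union) auto
      moreover have "(\<Union>S\<in>K. S) = (\<Union>S\<in>K. Some ` v S)"
        by (rule SUP_cong[OF refl]) (rule v(2))
      then have "\<Union> K = Some ` (\<Union>S\<in>K. v S)" by (simp add: image_UN)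
      ultimately show ?thesis by (intro disjI1 exI conjI)
    qed
  qed
  then show ?thesis by (simp add: indiscrete_cone_def)
qed

lemma topspace_indiscrete_cone:
  "topspace (indiscrete_cone A) = insert None (Some ` topspace A)"
proof
  show "topspace (indiscrete_cone A) \<subseteq> insert None (Some ` topspace A)"
    using openin_indiscrete_cone[of A "topspace (indiscrete_cone A)"] openin_subset[of A]
    by (simp, blast)
  show "insert None (Some ` topspace A) \<subseteq> topspace (indiscrete_cone A)"
    by (rule openin_subset) (simp add: openin_indiscrete_cone)
qed

text \<open>The cardinal \<open>\<kappa>\<close> is represented by a set \<open>I\<close> of cardinality \<open>\<kappa>\<close>, which serves both as the
  index set of the product here and as the index set of the coverings by tubes below.\<close>

definition E_space ::
  "('g, 'm) monoid_scheme \<Rightarrow> 'g topology \<Rightarrow> 'g set set \<Rightarrow> 'i set \<Rightarrow>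
   ('i \<Rightarrow> ('g set \<times> 'g set) option) topology" where
  "E_space G \<tau> F I =
     (let P = product_topology (\<lambda>_. indiscrete_cone (cosets_sum G \<tau> F)) I
      in subtopology P (topspace P - {\<lambda>i\<in>I. None}))"

definition E_act ::
  "('g, 'm) monoid_scheme \<Rightarrow> 'i set \<Rightarrow>
   ('i \<Rightarrow> ('g set \<times> 'g set) option) \<Rightarrow> 'g \<Rightarrow> ('i \<Rightarrow> ('g set \<times> 'g set) option)" where
  "E_act G I e g = (\<lambda>i\<in>I. cone_act (cosets_sum_act G) (e i) g)"

text \<open>The pairs \<open>(sh, g) ~ (s, hg)\<close>. They already form an equivalence relation
  (\<open>equiv_balanced_rel\<close>), so the points of \<open>S \<times>\<^sub>H G\<close> are its classes.\<close>

definition balanced_rel ::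
  "('g, 'm) monoid_scheme \<Rightarrow> 'g set \<Rightarrow> 's topology \<Rightarrow> ('s \<Rightarrow> 'g \<Rightarrow> 's) \<Rightarrow>
   (('s \<times> 'g) \<times> ('s \<times> 'g)) set" where
  "balanced_rel G H S b =
     {((b s h, g), (s, h \<otimes>\<^bsub>G\<^esub> g)) | s h g. s \<in> topspace S \<and> h \<in> H \<and> g \<in> carrier G}"

lemma right_space_closed:
  assumes "right_space G \<tau> X a" "x \<in> topspace X" "g \<in> topspace \<tau>"
  shows "a x g \<in> topspace X"
  using assms continuous_map_image_subset_topspace[of "prod_topology X \<tau>" X "\<lambda>(x, g). a x g"]
  by (force simp: right_space_def)

lemma equiv_balanced_rel:
  assumes G: "topological_group G \<tau>" and H: "subgroup H G"
    and S: "right_space (G\<lparr>carrier := H\<rparr>) (subtopology \<tau> H) S b"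
  shows "equiv (topspace S \<times> carrier G) (balanced_rel G H S b)"
proof -
  interpret group G using G by (simp add: topological_group_def)
  interpret H: subgroup H G by (rule H)
  have top: "topspace (subtopology \<tau> H) = H"
    using G H.subset by (auto simp: topological_group_def)
  have closed: "b s h \<in> topspace S" if "s \<in> topspace S" "h \<in> H" for s h
    using right_space_closed[OF S] that top by blast
  have one: "b s \<one>\<^bsub>G\<^esub> = s" if "s \<in> topspace S" for s
    using S that by (simp add: right_space_def)
  have mult: "b (b s h) k = b s (h \<otimes>\<^bsub>G\<^esub> k)" if "s \<in> topspace S" "h \<in> H" "k \<in> H" for s h k
    using S that by (simp add: right_space_def)
  have memI: "((b s h, g), (s, h \<otimes>\<^bsub>G\<^esub> g)) \<in> balanced_rel G H S b"
    if "s \<in> topspace S" "h \<in> H" "g \<in> carrier G" for s h g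
    using that unfolding balanced_rel_def by blast
  have memE: "\<exists>s h g. p = (b s h, g) \<and> q = (s, h \<otimes>\<^bsub>G\<^esub> g) \<and> s \<in> topspace S \<and> h \<in> H \<and> g \<in> carrier G"
    if "(p, q) \<in> balanced_rel G H S b" for p q
    using that unfolding balanced_rel_def by blast
  show ?thesis
  proof (rule equivI)
    show "balanced_rel G H S b \<subseteq> (topspace S \<times> carrier G) \<times> (topspace S \<times> carrier G)"
      using closed H.mem_carrier by (auto simp: balanced_rel_def)
    show "refl_on (topspace S \<times> carrier G) (balanced_rel G H S b)"
    proof (rule refl_onI)
      fix p assume "p \<in> topspace S \<times> carrier G"
      then obtain s g where p: "p = (s, g)" "s \<in> topspace S" "g \<in> carrier G" by blast
      show "(p, p) \<in> balanced_rel G H S b"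
        using memI[OF p(2) H.one_closed p(3)] one[OF p(2)] p(1,3) by simp
    qed
    show "sym (balanced_rel G H S b)"
    proof (rule symI)
      fix p q assume "(p, q) \<in> balanced_rel G H S b"
      then obtain s h g where pq: "p = (b s h, g)" "q = (s, h \<otimes>\<^bsub>G\<^esub> g)"
        and s: "s \<in> topspace S" and h: "h \<in> H" and g: "g \<in> carrier G"
        using memE by blast
      have hG: "h \<in> carrier G" using h by (rule H.mem_carrier)
      have "b (b s h) (inv\<^bsub>G\<^esub> h) = s"
        using mult[OF s h H.m_inv_closed[OF h]] one[OF s] hG by simp
      moreover have "inv\<^bsub>G\<^esub> h \<otimes>\<^bsub>G\<^esub> (h \<otimes>\<^bsub>G\<^esub> g) = g"
        using hG g by (simp add: m_assoc[symmetric])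
      ultimately show "(q, p) \<in> balanced_rel G H S b"
        using memI[OF closed[OF s h] H.m_inv_closed[OF h] m_closed[OF hG g]] pq by simp
    qed
    show "trans (balanced_rel G H S b)"
    proof (rule transI)
      fix p q r assume pq: "(p, q) \<in> balanced_rel G H S b" and qr: "(q, r) \<in> balanced_rel G H S b"
      obtain s h g where p: "p = (b s h, g)" and q: "q = (s, h \<otimes>\<^bsub>G\<^esub> g)"
        and h: "h \<in> H" and g: "g \<in> carrier G"
        using memE[OF pq] by blast
      obtain s' h' g' where q': "q = (b s' h', g')" and r: "r = (s', h' \<otimes>\<^bsub>G\<^esub> g')"
        and s': "s' \<in> topspace S" and h': "h' \<in> H"
        using memE[OF qr] by blast
      have eq: "s = b s' h'" "g' = h \<otimes>\<^bsub>G\<^esub> g" using q q' by simp_all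
      have "p = (b s' (h' \<otimes>\<^bsub>G\<^esub> h), g)" unfolding p eq(1) mult[OF s' h' h] ..
      moreover have "r = (s', (h' \<otimes>\<^bsub>G\<^esub> h) \<otimes>\<^bsub>G\<^esub> g)"
        unfolding r eq(2) m_assoc[OF H.mem_carrier[OF h'] H.mem_carrier[OF h] g] ..
      ultimately show "(p, r) \<in> balanced_rel G H S b"
        using memI[OF s' H.m_closed[OF h' h] g] by simp
    qed
  qed
qed

definition balanced_product ::
  "('g, 'm) monoid_scheme \<Rightarrow> 'g topology \<Rightarrow> 'g set \<Rightarrow> 's topology \<Rightarrow> ('s \<Rightarrow> 'g \<Rightarrow> 's) \<Rightarrow>
   ('s \<times> 'g) set topology" where
  "balanced_product G \<tau> H S b =
     quotient_topology (prod_topology S \<tau>) (\<lambda>p. balanced_rel G H S b `` {p})"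

definition balanced_act ::
  "('g, 'm) monoid_scheme \<Rightarrow> ('s \<times> 'g) set \<Rightarrow> 'g \<Rightarrow> ('s \<times> 'g) set" where
  "balanced_act G C x = (\<lambda>(s, g). (s, g \<otimes>\<^bsub>G\<^esub> x)) ` C"

text \<open>The \<open>H\<close>-space \<open>S\<close> may be taken on the point type of \<open>X\<close> without loss of generality:
  \<open>s \<mapsto> [s, 1]\<close> is an \<open>H\<close>-equivariant topological embedding of \<open>S\<close> into \<open>S \<times>\<^sub>H G\<close>, hence into
  the tube.\<close>

definition tube ::
  "('g, 'm) monoid_scheme \<Rightarrow> 'g topology \<Rightarrow> 'g set set \<Rightarrow>
   'x topology \<Rightarrow> ('x \<Rightarrow> 'g \<Rightarrow> 'x) \<Rightarrow> 'x set \<Rightarrow> bool" where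
  "tube G \<tau> F X a T \<longleftrightarrow>
     openin X T \<and> (\<forall>x\<in>T. \<forall>g\<in>carrier G. a x g \<in> T) \<and>
     (\<exists>H\<in>F. \<exists>(S :: 'x topology) b f.
        right_space (G\<lparr>carrier := H\<rparr>) (subtopology \<tau> H) S b \<and>
        homeomorphic_map (subtopology X T) (balanced_product G \<tau> H S b) f \<and>
        equivariant G (subtopology X T) a (balanced_act G) f)"

definition covered_by_tubes ::
  "('g, 'm) monoid_scheme \<Rightarrow> 'g topology \<Rightarrow> 'g set set \<Rightarrow> 'i set \<Rightarrow>
   'x topology \<Rightarrow> ('x \<Rightarrow> 'g \<Rightarrow> 'x) \<Rightarrow> bool" where
  "covered_by_tubes G \<tau> F I X a \<longleftrightarrow>
     (\<exists>T. (\<forall>i\<in>I. tube G \<tau> F X a (T i)) \<and> topspace X = (\<Union>i\<in>I. T i))"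

definition tube_covered_space ::
  "('g, 'm) monoid_scheme \<Rightarrow> 'g topology \<Rightarrow> 'g set set \<Rightarrow> 'i set \<Rightarrow>
   'x topology \<Rightarrow> ('x \<Rightarrow> 'g \<Rightarrow> 'x) \<Rightarrow> bool" where
  "tube_covered_space G \<tau> F I X a \<longleftrightarrow> right_space G \<tau> X a \<and> covered_by_tubes G \<tau> F I X a"

text \<open>Every object \<open>X\<close> has exactly one morphism to \<open>Y\<close> in the category of tube-covered spaces and
  \<open>G\<close>-homotopy classes. The type \<open>'x\<close> of points of \<open>X\<close> is a parameter, since it cannot be
  quantified over inside a formula; a theorem about \<^term>\<open>TYPE('x)\<close> with \<open>'x\<close> free covers the
  spaces on all types.\<close>

definition unique_morphisms_to ::
  "'x itself \<Rightarrow> ('g, 'm) monoid_scheme \<Rightarrow> 'g topology \<Rightarrow> 'g set set \<Rightarrow> 'i set \<Rightarrow>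
   'y topology \<Rightarrow> ('y \<Rightarrow> 'g \<Rightarrow> 'y) \<Rightarrow> bool" where
  "unique_morphisms_to _ G \<tau> F I Y b \<longleftrightarrow>
     (\<forall>(X :: 'x topology) a. tube_covered_space G \<tau> F I X a \<longrightarrow>
        (\<exists>!c. c \<in> G_homotopy_classes G X a Y b))"

definition final_object ::
  "'x itself \<Rightarrow> ('g, 'm) monoid_scheme \<Rightarrow> 'g topology \<Rightarrow> 'g set set \<Rightarrow> 'i set \<Rightarrow>
   'y topology \<Rightarrow> ('y \<Rightarrow> 'g \<Rightarrow> 'y) \<Rightarrow> bool" where
  "final_object t G \<tau> F I Y b \<longleftrightarrow>
     tube_covered_space G \<tau> F I Y b \<and> unique_morphisms_to t G \<tau> F I Y b"

text \<open>At most \<open>\<kappa>\<close> many members of \<open>F\<close>, and at least one, suffice to contain every member of \<open>F\<close> up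
  to conjugacy. This is automatic if \<open>0 < card F \<le> \<kappa>\<close>, but not in general: it fails for
  \<open>F = {}\<close>, and for the uncountable set of lines in the plane with \<open>\<kappa>\<close> countable. It is
  necessary for \<open>E_space\<close> to be covered by \<open>\<kappa>\<close> many tubes (\<open>dominated_if_covered\<close>), because each
  single tube involves just one subgroup, whereas every \<open>H \<in> F\<close> is the stabiliser of a point of
  \<open>E_space\<close>.\<close>

definition dominated :: "('g, 'm) monoid_scheme \<Rightarrow> 'g set set \<Rightarrow> 'i set \<Rightarrow> bool" where
  "dominated G F I \<longleftrightarrow>
     (\<exists>F'\<subseteq>F. F' \<noteq> {} \<and> F' \<lesssim> I \<and>
        (\<forall>H\<in>F. \<exists>K\<in>F'. \<exists>g\<in>carrier G. \<forall>h\<in>H. g \<otimes>\<^bsub>G\<^esub> h \<otimes>\<^bsub>G\<^esub> inv\<^bsub>G\<^esub> g \<in> K))"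

lemma dominated_if_lepoll:
  assumes "group G" "\<And>H. H \<in> F \<Longrightarrow> subgroup H G" "F \<noteq> {}" "F \<lesssim> I"
  shows "dominated G F I"
proof -
  interpret group G by fact
  have "\<one>\<^bsub>G\<^esub> \<otimes>\<^bsub>G\<^esub> h \<otimes>\<^bsub>G\<^esub> inv\<^bsub>G\<^esub> \<one>\<^bsub>G\<^esub> \<in> H" if "H \<in> F" "h \<in> H" for H h
    using subgroup.mem_carrier[OF assms(2)[OF that(1)] that(2)] that(2) by simp
  then have "\<forall>H\<in>F. \<exists>K\<in>F. \<exists>g\<in>carrier G. \<forall>h\<in>H. g \<otimes>\<^bsub>G\<^esub> h \<otimes>\<^bsub>G\<^esub> inv\<^bsub>G\<^esub> g \<in> K"
    using one_closed by blast
  then show ?thesis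
    unfolding dominated_def using assms(3,4) by (intro exI[of _ F] conjI subset_refl)
qed

lemma tube_stabilisers:
  fixes X :: "'x topology"
  assumes G: "topological_group G \<tau>" and F: "\<And>H. H \<in> F \<Longrightarrow> subgroup H G"
    and T: "tube G \<tau> F X a T"
  shows "\<exists>K\<in>F. \<forall>x\<in>T. \<exists>g\<in>carrier G. \<forall>h\<in>carrier G. a x h = x \<longrightarrow> g \<otimes>\<^bsub>G\<^esub> h \<otimes>\<^bsub>G\<^esub> inv\<^bsub>G\<^esub> g \<in> K"
proof -
  interpret group G using G by (simp add: topological_group_def)
  obtain K and S :: "'x topology" and b f where KF: "K \<in> F"
    and S: "right_space (G\<lparr>carrier := K\<rparr>) (subtopology \<tau> K) S b"
    and hf: "homeomorphic_map (subtopology X T) (balanced_product G \<tau> K S b) f"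
    and ef: "equivariant G (subtopology X T) a (balanced_act G) f"
    using T unfolding tube_def by blast
  let ?R = "balanced_rel G K S b"
  interpret K: subgroup K G by (rule F[OF KF])
  have eqv: "equiv (topspace S \<times> carrier G) ?R"
    by (rule equiv_balanced_rel[OF G F[OF KF] S])
  have "\<exists>g\<in>carrier G. \<forall>h\<in>carrier G. a x h = x \<longrightarrow> g \<otimes>\<^bsub>G\<^esub> h \<otimes>\<^bsub>G\<^esub> inv\<^bsub>G\<^esub> g \<in> K" if "x \<in> T" for x
  proof -
    have "openin X T" using T unfolding tube_def by blast
    then have x: "x \<in> topspace (subtopology X T)"
      using that openin_subset[of X T] by auto
    then have "f x \<in> topspace (balanced_product G \<tau> K S b)"
      using homeomorphic_imp_surjective_map[OF hf] by blast
    then obtain s g where fx: "f x = ?R `` {(s, g)}" and s: "s \<in> topspace S" and g: "g \<in> carrier G"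
      using G by (auto simp: balanced_product_def topspace_quotient_topology topological_group_def)
    have "g \<otimes>\<^bsub>G\<^esub> h \<otimes>\<^bsub>G\<^esub> inv\<^bsub>G\<^esub> g \<in> K" if h: "h \<in> carrier G" "a x h = x" for h
    proof -
      have eq: "f x = balanced_act G (f x) h"
        using ef x h unfolding equivariant_def by force
      have "(s, g) \<in> f x"
        unfolding fx using equiv_class_self[OF eqv] s g by blast
      then have "(s, g \<otimes>\<^bsub>G\<^esub> h) \<in> balanced_act G (f x) h"
        unfolding balanced_act_def by (rule rev_image_eqI) simp
      then have "(s, g \<otimes>\<^bsub>G\<^esub> h) \<in> f x" using eq by simp
      then have "((s, g), (s, g \<otimes>\<^bsub>G\<^esub> h)) \<in> ?R" unfolding fx by simp
      then obtain k where k: "k \<in> K" "g \<otimes>\<^bsub>G\<^esub> h = k \<otimes>\<^bsub>G\<^esub> g"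
        by (auto simp: balanced_rel_def)
      have "g \<otimes>\<^bsub>G\<^esub> h \<otimes>\<^bsub>G\<^esub> inv\<^bsub>G\<^esub> g = k"
        unfolding k(2) using g K.mem_carrier[OF k(1)] by (simp add: m_assoc)
      then show ?thesis using k by simp
    qed
    then show ?thesis using g by blast
  qed
  then show ?thesis using KF by blast
qed

lemma dominated_if_covered:
  assumes G: "topological_group G \<tau>" and F: "\<And>H. H \<in> F \<Longrightarrow> subgroup H G" and I: "infinite I"
    and cov: "covered_by_tubes G \<tau> F I (E_space G \<tau> F I) (E_act G I)"
  shows "dominated G F I"
proof -
  interpret group G using G by (simp add: topological_group_def)
  let ?E = "E_space G \<tau> F I"
  obtain T where T: "\<And>i. i \<in> I \<Longrightarrow> tube G \<tau> F ?E (E_act G I) (T i)"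
    and E: "topspace ?E = (\<Union>i\<in>I. T i)"
    using cov unfolding covered_by_tubes_def by blast
  define P where "P i L \<longleftrightarrow> L \<in> F \<and> (\<forall>x\<in>T i. \<exists>g\<in>carrier G. \<forall>h\<in>carrier G.
      E_act G I x h = x \<longrightarrow> g \<otimes>\<^bsub>G\<^esub> h \<otimes>\<^bsub>G\<^esub> inv\<^bsub>G\<^esub> g \<in> L)" for i L
  define K where "K i = (SOME L. P i L)" for i
  have ex: "\<exists>L. P i L" if "i \<in> I" for i
    using tube_stabilisers[OF G F T[OF that]] unfolding P_def by blast
  have K: "P i (K i)" if "i \<in> I" for i
    unfolding K_def by (rule someI_ex[OF ex[OF that]])
  obtain i0 where i0: "i0 \<in> I" using infinite_imp_nonempty[OF I] by blast
  have "\<exists>L\<in>K ` I. \<exists>g\<in>carrier G. \<forall>h\<in>H. g \<otimes>\<^bsub>G\<^esub> h \<otimes>\<^bsub>G\<^esub> inv\<^bsub>G\<^esub> g \<in> L" if HF: "H \<in> F" for H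
  proof -
    interpret H: subgroup H G by (rule F[OF HF])
    define e where "e = (\<lambda>i\<in>I. if i = i0 then Some (H, H) else None)"
    have "H \<in> topspace (coset_space G \<tau> H)"
    proof -
      have "H = H #>\<^bsub>G\<^esub> \<one>\<^bsub>G\<^esub>" using H.subset by simp
      then show ?thesis
        using G by (auto simp: coset_space_def topspace_quotient_topology topological_group_def)
    qed
    then have "(H, H) \<in> topspace (cosets_sum G \<tau> F)"
      using HF by (simp add: cosets_sum_def)
    moreover have "e i0 \<noteq> (\<lambda>i\<in>I. None) i0"
      using i0 by (simp add: e_def)
    then have "e \<noteq> (\<lambda>i\<in>I. None)" by (rule contrapos_nn) simp
    ultimately have "e \<in> topspace ?E"
      by (auto simp: E_space_def Let_def topspace_indiscrete_cone e_def)
    then obtain j where j: "j \<in> I" "e \<in> T j" using E by blast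
    have fixed: "E_act G I e h = e" if h: "h \<in> H" for h
    proof -
      have "H #>\<^bsub>G\<^esub> h = H"
        using coset_join2[OF H.mem_carrier[OF h] F[OF HF] h] .
      then show ?thesis
        by (auto simp: E_act_def e_def cone_act_def cosets_sum_act_def fun_eq_iff)
    qed
    have "\<forall>x\<in>T j. \<exists>g\<in>carrier G. \<forall>h\<in>carrier G.
      E_act G I x h = x \<longrightarrow> g \<otimes>\<^bsub>G\<^esub> h \<otimes>\<^bsub>G\<^esub> inv\<^bsub>G\<^esub> g \<in> K j"
      using K[OF j(1)] unfolding P_def by (rule conjunct2)
    then obtain g where g: "g \<in> carrier G"
      "\<And>h. \<lbrakk>h \<in> carrier G; E_act G I e h = e\<rbrakk> \<Longrightarrow> g \<otimes>\<^bsub>G\<^esub> h \<otimes>\<^bsub>G\<^esub> inv\<^bsub>G\<^esub> g \<in> K j"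
      using j(2) by blast
    have "\<forall>h\<in>H. g \<otimes>\<^bsub>G\<^esub> h \<otimes>\<^bsub>G\<^esub> inv\<^bsub>G\<^esub> g \<in> K j"
      using g(2) fixed H.mem_carrier by simp
    then show ?thesis using g(1) j(1) by (intro bexI[of _ "K j"] bexI[of _ g]) auto
  qed
  moreover have "K ` I \<subseteq> F" using K by (auto simp: P_def)
  moreover have "K ` I \<noteq> {}" using i0 by blast
  moreover have "K ` I \<lesssim> I" by (rule image_lepoll)
  ultimately show ?thesis
    unfolding dominated_def by (intro exI[of _ "K ` I"]) simp
qed

end

theory Submission
  imports Defs
begin

text \<open>The only neighbourhood of the cone point in \<open>c(A)\<close> is the whole cone, so a map \<open>X \<rightarrow> c(A)\<close> is
  nothing but an open subset of \<open>X\<close> with a map from it to \<open>A\<close>: outside that open set the value is the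
  cone point, and no continuity condition arises at its boundary. A map to \<open>E_space\<close> is therefore a
  family of partially defined maps to \<open>F\G\<close>, indexed by \<open>I\<close>, whose open domains cover \<open>X\<close>.

  Existence. A tube \<open>S \<times>\<^sub>H G\<close> maps to \<open>H\G\<close> by \<open>[s, g] \<mapsto> Hg\<close>, so a cover by tubes indexed by \<open>I\<close> is
  such a family (\<open>G_map_to_E_space_exists\<close>).

  Uniqueness up to homotopy. A coordinate may at any time be switched off, and be switched on again
  immediately afterwards with different content; both are continuous by the description of maps to
  the cone. Hence a homotopy from \<open>f\<close> to \<open>f'\<close> can be prescribed by a schedule that says which
  coordinate of \<open>f\<close> or of \<open>f'\<close> is displayed in coordinate \<open>i\<close> at time \<open>t\<close>, independently of \<open>X\<close> and of
  the maps. The one condition is that the point displayed is never the cone point in all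
  coordinates, and this is guaranteed if at each time all coordinates of \<open>f\<close>, or all those of \<open>f'\<close>,
  are on display somewhere. Since \<open>I\<close> is infinite, \<open>I \<cong> I \<times> \<nat>\<close>, and there is room to keep a second copy
  of a coordinate while it is being switched (\<open>schedule_exists\<close>). As any two \<open>G\<close>-maps to \<open>E_space\<close> are
  thus homotopic, there is only one class.

  \<open>E_space\<close> as an object. Conversely to the above, an open \<open>G\<close>-subset \<open>T\<close> with a \<open>G\<close>-map to \<open>K\G\<close> is a
  tube, with the fibre over the coset \<open>K\<close> as \<open>S\<close> (\<open>tube_if_map_to_coset_space\<close>). If \<open>\<gamma>H\<gamma>\<^sup>-\<^sup>1 \<le> K\<close>, then
  \<open>Hx \<mapsto> K\<gamma>x\<close> is a \<open>G\<close>-map \<open>H\G \<rightarrow> K\G\<close>. So for \<open>K\<close> in the small dominating set \<open>F'\<close>, the points whose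
  coordinate \<open>i\<close> lies in some \<open>H\G\<close> with \<open>H\<close> assigned to \<open>K\<close> form one tube over \<open>K\<close>; there are
  \<open>card (I \<times> F') = card I\<close> of these, and they cover (\<open>tube_covered_E_space\<close>).\<close>

section \<open>Maps into the indiscrete cone and into its power\<close>

text \<open>The only open set that contains the cone point imposes no condition on a map.\<close>

lemma continuous_map_indiscrete_cone:
  "continuous_map Y (indiscrete_cone A) f \<longleftrightarrow>
     f \<in> topspace Y \<rightarrow> insert None (Some ` topspace A) \<and>
     (\<forall>V. openin A V \<longrightarrow> openin Y {y \<in> topspace Y. f y \<in> Some ` V})"
    (is "?L \<longleftrightarrow> ?R")
proof
  assume ?L
  then show ?R
    unfolding continuous_map_def topspace_indiscrete_cone openin_indiscrete_cone by blast
next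
  assume R: ?R
  have "openin Y {y \<in> topspace Y. f y \<in> U}" if U: "openin (indiscrete_cone A) U" for U
  proof (cases "U = insert None (Some ` topspace A)")
    case True
    then have "{y \<in> topspace Y. f y \<in> U} = topspace Y" using R by auto
    then show ?thesis by simp
  next
    case False
    then show ?thesis using U R by (auto simp: openin_indiscrete_cone)
  qed
  then show ?L using R by (simp add: continuous_map_def topspace_indiscrete_cone)
qed

lemma ne_restrict_None_iff:
  assumes "e \<in> extensional I"
  shows "e \<noteq> (\<lambda>i\<in>I. None) \<longleftrightarrow> (\<exists>i\<in>I. e i \<noteq> None)"
  using assms by (auto simp: fun_eq_iff extensional_def)

lemma topspace_E_space:
  fixes I :: "'i set" and G :: "('g, 'm) monoid_scheme"
  shows "topspace (E_space G \<tau> F I) =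
     {e \<in> Pi\<^sub>E I (\<lambda>_. insert None (Some ` topspace (cosets_sum G \<tau> F))). \<exists>i\<in>I. e i \<noteq> None}"
  by (auto simp: E_space_def Let_def topspace_indiscrete_cone PiE_def ne_restrict_None_iff)

lemma continuous_map_E_space:
  fixes I :: "'i set" and G :: "('g, 'm) monoid_scheme"
  shows "continuous_map Y (E_space G \<tau> F I) h \<longleftrightarrow>
     h \<in> topspace Y \<rightarrow> extensional I \<and>
     (\<forall>i\<in>I. continuous_map Y (indiscrete_cone (cosets_sum G \<tau> F)) (\<lambda>y. h y i)) \<and>
     (\<forall>y\<in>topspace Y. \<exists>i\<in>I. h y i \<noteq> None)" (is "?L \<longleftrightarrow> ?R")
proof -
  let ?C = "indiscrete_cone (cosets_sum G \<tau> F)"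
  let ?P = "product_topology (\<lambda>_. ?C) I"
  have "?L \<longleftrightarrow> continuous_map Y ?P h \<and> h \<in> topspace Y \<rightarrow> topspace ?P - {\<lambda>i\<in>I. None}"
    by (simp add: E_space_def Let_def continuous_map_in_subtopology image_subset_iff_funcset)
  also have "\<dots> \<longleftrightarrow> continuous_map Y ?P h \<and> (\<forall>y\<in>topspace Y. h y \<noteq> (\<lambda>i\<in>I. None))"
    by (auto simp: continuous_map_def)
  also have "\<dots> \<longleftrightarrow> ?R"
    by (auto simp: continuous_map_componentwise image_subset_iff_funcset Pi_iff ne_restrict_None_iff)
  finally show ?thesis .
qed

lemma continuous_map_E_space_component:
  assumes "i \<in> I"
  shows "continuous_map (E_space G \<tau> F I) (indiscrete_cone (cosets_sum G \<tau> F)) (\<lambda>e. e i)"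
  using continuous_map_E_space[of "E_space G \<tau> F I" G \<tau> F I "\<lambda>e. e"] assms by simp

section \<open>Homotopies given by schedules\<close>

text \<open>The value is \<^term>\<open>None\<close> at the three switching times themselves. The times at which a given
  value is taken then form an open set, even though the value jumps.\<close>

definition phases :: "real \<Rightarrow> real \<Rightarrow> real \<Rightarrow> 'k \<Rightarrow> 'k \<Rightarrow> 'k \<Rightarrow> 'k \<Rightarrow> real \<Rightarrow> 'k option" where
  "phases p q r a b c d t =
     (if t < p then Some a else if p < t \<and> t < q then Some b
      else if q < t \<and> t < r then Some c else if r < t then Some d else None)"

lemma open_phases:
  assumes "p < q" "q < r"
  shows "open {t. phases p q r a b c d t = Some k}"
proof -
  have "{t. phases p q r a b c d t = Some k} =
      (if a = k then {..<p} else {}) \<union> (if b = k then {p<..<q} else {}) \<union>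
      (if c = k then {q<..<r} else {}) \<union> (if d = k then {r<..} else {})"
    using assms by (auto simp: phases_def split: if_splits)
  then show ?thesis by (auto intro!: open_Un)
qed

text \<open>\<^term>\<open>ph i t = Some (b, j)\<close> means that at time \<open>t\<close> the coordinate \<open>i\<close> of the homotopy shows the
  coordinate \<open>j\<close> of its start map (\<open>b = False\<close>) or of its end map (\<open>b = True\<close>);
  \<^term>\<open>ph i t = None\<close> means that it shows the cone point. The last clause makes one of the two maps
  completely visible at every time, which keeps the homotopy away from the point that \<open>E_space\<close>
  omits.\<close>

definition schedule :: "'i set \<Rightarrow> ('i \<Rightarrow> real \<Rightarrow> (bool \<times> 'i) option) \<Rightarrow> bool" where
  "schedule I ph \<longleftrightarrow>
     (\<forall>i\<in>I. (\<forall>k. open {t. ph i t = Some k}) \<and> (\<forall>t b j. ph i t = Some (b, j) \<longrightarrow> j \<in> I) \<and>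
        ph i (-1) = Some (False, i) \<and> ph i 1 = Some (True, i)) \<and>
     (\<forall>t. \<exists>b. \<forall>j\<in>I. \<exists>i\<in>I. ph i t = Some (b, j))"

lemma Times_eqpoll_infinite:
  assumes "infinite A" "B \<noteq> {}" "B \<lesssim> A"
  shows "A \<times> B \<approx> A"
  using card_of_Times_infinite[of A B] assms card_of_ordIso[of "A \<times> B" A] card_of_ordLeq[of B A]
  unfolding eqpoll_def lepoll_def by blast

text \<open>Arrange \<open>I\<close> in rows \<open>n = 0, 1, 2, \<dots>\<close>, each indexed by \<open>I\<close>, via \<open>I \<times> \<nat> \<cong> I\<close>. Starting at time \<open>-1\<close>, the
  start map is shifted down by one row. Row \<open>n\<close> is overwritten with the old contents of row \<open>n - 1\<close> at
  time \<open>s n\<close>, after row \<open>n + 1\<close> has received a copy of row \<open>n\<close>, so the times \<open>s n\<close> must decrease with \<open>n\<close>.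
  They tend to \<open>-1\<close>; infinitely many switches right after the start are harmless, as openness is
  required in each coordinate separately. At time \<open>s 0\<close> the row \<open>0\<close>, which is a copy of \<open>I\<close>, becomes
  free and receives another complete copy of the start map. This allows all other rows to be
  overwritten at time \<open>0\<close>. The end map enters them in its own shifted form, and its shift is undone
  by running the same process backwards.\<close>

lemma schedule_exists:
  assumes "infinite I"
  shows "\<exists>ph. schedule I ph"
proof -
  have "I \<times> (UNIV :: nat set) \<approx> I"
    using assms by (intro Times_eqpoll_infinite) (simp_all add: infinite_le_lepoll)
  then obtain \<beta> where \<beta>: "bij_betw \<beta> (I \<times> (UNIV :: nat set)) I"
    by (auto simp: eqpoll_def)
  define \<delta> where "\<delta> = the_inv_into (I \<times> (UNIV :: nat set)) \<beta>"
  have \<delta>\<beta>: "\<delta> (\<beta> (j, n)) = (j, n)" if "j \<in> I" for j n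
    using \<beta> that by (simp add: \<delta>_def bij_betw_def the_inv_into_f_f)
  have \<beta>I: "\<beta> (j, n) \<in> I" if "j \<in> I" for j n
    using \<beta> that by (auto simp: bij_betw_def)
  have \<beta>E: "\<exists>j\<in>I. \<exists>n. i = \<beta> (j, n)" if "i \<in> I" for i
    using \<beta> that by (force simp: bij_betw_def)
  define s :: "nat \<Rightarrow> real" where "s n = -1 + 1 / (real n + 2)" for n
  \<comment> \<open>The start map is replaced by the end map in row \<open>n\<close> at time \<open>c n\<close>. Row \<open>0\<close> has to show the start
      map at time \<open>0\<close>, when the other rows are replaced, so its own turn comes later.\<close>
  define c :: "nat \<Rightarrow> real" where "c n = (if n = 0 then 1/4 else 0)" for n
  \<comment> \<open>The coordinate shown in the middle phases. In row \<open>0\<close> the index \<open>j\<close> itself runs over all of \<open>I\<close>.\<close>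
  define prev where "prev j n = (case n of 0 \<Rightarrow> j | Suc m \<Rightarrow> \<beta> (j, m))" for j n
  define ph where "ph i = (case \<delta> i of (j, n) \<Rightarrow> phases (s n) (c n) (- s n)
      (False, i) (False, prev j n) (True, prev j n) (True, i))" for i
  have ph: "ph (\<beta> (j, n)) = phases (s n) (c n) (- s n)
      (False, \<beta> (j, n)) (False, prev j n) (True, prev j n) (True, \<beta> (j, n))" if "j \<in> I" for j n
    using that by (simp add: ph_def \<delta>\<beta>)
  have s: "-1 < s n" "s n < c n" "c n < - s n" "s n \<le> -1/2" "s (Suc n) < s n" for n
    by (auto simp: s_def c_def field_simps)
  have prevI: "prev j n \<in> I" if "j \<in> I" for j n
    using that \<beta>I by (auto simp: prev_def split: nat.split)
  have "(\<forall>k. open {t. ph i t = Some k}) \<and> (\<forall>t b j. ph i t = Some (b, j) \<longrightarrow> j \<in> I) \<and>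
        ph i (-1) = Some (False, i) \<and> ph i 1 = Some (True, i)" if iI: "i \<in> I" for i
  proof -
    obtain j n where j: "j \<in> I" and i: "i = \<beta> (j, n)" using \<beta>E[OF iI] by blast
    show ?thesis
      unfolding i ph[OF j]
    proof (intro conjI allI impI)
      show "open {t. phases (s n) (c n) (- s n) (False, \<beta> (j, n)) (False, prev j n)
          (True, prev j n) (True, \<beta> (j, n)) t = Some k}" for k
        using s(2,3) by (rule open_phases)
    qed (use s[of n] prevI[OF j, of n] \<beta>I[OF j, of n] in \<open>auto simp: phases_def split: if_splits\<close>)
  qed
  moreover have "\<exists>b. \<forall>k\<in>I. \<exists>i\<in>I. ph i t = Some (b, k)" for t
  proof -
    consider "t \<le> -1/2" | "-1/2 < t" "t < 1/4" | "1/4 \<le> t" by linarith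
    then show ?thesis
    proof cases
      case 1
      have "\<exists>i\<in>I. ph i t = Some (False, k)" if kI: "k \<in> I" for k
      proof -
        obtain j n where j: "j \<in> I" and k: "k = \<beta> (j, n)" using \<beta>E[OF kI] by blast
        show ?thesis
        proof (cases "t < s n")
          case True
          then have "ph k t = Some (False, k)" by (simp add: k ph[OF j] phases_def)
          then show ?thesis using kI by blast
        next
          case False
          then have "ph (\<beta> (j, Suc n)) t = Some (False, k)"
            using 1 s(5)[of n] by (simp add: k ph[OF j] phases_def c_def prev_def)
          then show ?thesis using \<beta>I[OF j] by blast
        qed
      qed
      then show ?thesis by blast
    next
      case 2
      then have "ph (\<beta> (j, 0)) t = Some (False, j)" if "j \<in> I" for j
        by (simp add: ph[OF that] phases_def s_def c_def prev_def)
      then show ?thesis using \<beta>I by blast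
    next
      case 3
      have "\<exists>i\<in>I. ph i t = Some (True, k)" if kI: "k \<in> I" for k
      proof -
        obtain j n where j: "j \<in> I" and k: "k = \<beta> (j, n)" using \<beta>E[OF kI] by blast
        show ?thesis
        proof (cases "- s n < t")
          case True
          then have "ph k t = Some (True, k)"
            using s[of n] by (simp add: k ph[OF j] phases_def)
          then show ?thesis using kI by blast
        next
          case False
          then have "ph (\<beta> (j, Suc n)) t = Some (True, k)"
            using 3 s(5)[of n] s(4)[of "Suc n"] by (simp add: k ph[OF j] phases_def c_def prev_def)
          then show ?thesis using \<beta>I[OF j] by blast
        qed
      qed
      then show ?thesis by blast
    qed
  qed
  ultimately show ?thesis unfolding schedule_def by blast
qed

lemma continuous_map_scheduled:
  assumes ph: "\<And>k. open {t. ph t = Some k}"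
    and u: "\<And>t k. ph t = Some k \<Longrightarrow> continuous_map X (indiscrete_cone A) (u k)"
  shows "continuous_map (prod_topology X (top_of_set {-1..1::real})) (indiscrete_cone A)
    (\<lambda>(x, t). case ph t of None \<Rightarrow> None | Some k \<Rightarrow> u k x)"
  unfolding continuous_map_indiscrete_cone
proof (intro conjI allI impI)
  let ?Y = "prod_topology X (top_of_set {-1..1::real})"
  let ?h = "\<lambda>(x, t). case ph t of None \<Rightarrow> None | Some k \<Rightarrow> u k x"
  show "?h \<in> topspace ?Y \<rightarrow> insert None (Some ` topspace A)"
    using u by (fastforce simp: continuous_map_indiscrete_cone split: option.split)
  fix V assume V: "openin A V"
  have "openin ?Y ({x \<in> topspace X. u k x \<in> Some ` V} \<times> ({-1..1} \<inter> {t. ph t = Some k}))" for k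
  proof (cases "\<exists>t. ph t = Some k")
    case True
    then have "openin X {x \<in> topspace X. u k x \<in> Some ` V}"
      using u V unfolding continuous_map_indiscrete_cone by blast
    then show ?thesis using ph[of k] by (auto simp: openin_prod_Times_iff openin_open)
  next
    case False
    then show ?thesis by simp
  qed
  then have "openin ?Y (\<Union>k. {x \<in> topspace X. u k x \<in> Some ` V} \<times> ({-1..1} \<inter> {t. ph t = Some k}))"
    by blast
  moreover have "{y \<in> topspace ?Y. ?h y \<in> Some ` V} =
      (\<Union>k. {x \<in> topspace X. u k x \<in> Some ` V} \<times> ({-1..1} \<inter> {t. ph t = Some k}))"
    by (auto split: option.splits)
  ultimately show "openin ?Y {y \<in> topspace ?Y. ?h y \<in> Some ` V}" by simp
qed

text \<open>The two maps form a family over \<^typ>\<open>bool\<close>, so that an entry \<open>(b, j)\<close> of a schedule refers to the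
  coordinate \<open>j\<close> of \<open>f b\<close>.\<close>

lemma G_homotopic_E_space:
  assumes I: "infinite I"
    and f: "\<And>b. G_map G X a (E_space G \<tau> F I) (E_act G I) (f b)"
  shows "G_homotopic G X a (E_space G \<tau> F I) (E_act G I) (f False) (f True)"
proof -
  let ?A = "cosets_sum G \<tau> F"
  let ?Y = "prod_topology X (top_of_set {-1..1::real})"
  let ?a = "\<lambda>(x, t) g. (a x g, t)"
  have f_cont: "\<And>b i. i \<in> I \<Longrightarrow> continuous_map X (indiscrete_cone ?A) (\<lambda>x. f b x i)"
    and f_ext: "\<And>b. f b \<in> topspace X \<rightarrow> extensional I"
    and f_nz: "\<And>b x. x \<in> topspace X \<Longrightarrow> \<exists>i\<in>I. f b x i \<noteq> None"
    using f unfolding G_map_def continuous_map_E_space by blast+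
  have f_eq: "f b (a x g) j = cone_act (cosets_sum_act G) (f b x j) g"
    if "j \<in> I" "x \<in> topspace X" "g \<in> carrier G" for b j x g
    using f[of b] that by (simp add: G_map_def equivariant_def E_act_def)
  obtain ph where ph: "schedule I ph" using schedule_exists[OF I] ..
  define u where "u = (\<lambda>(b, j) x. f b x j)"
  define h where "h = (\<lambda>(x, t). \<lambda>i\<in>I. case ph i t of None \<Rightarrow> None | Some k \<Rightarrow> u k x)"
  have "continuous_map ?Y (E_space G \<tau> F I) h"
    unfolding continuous_map_E_space
  proof (intro conjI ballI)
    show "h \<in> topspace ?Y \<rightarrow> extensional I" by (auto simp: h_def)
  next
    fix i assume i: "i \<in> I"
    have "continuous_map ?Y (indiscrete_cone ?A)
        (\<lambda>(x, t). case ph i t of None \<Rightarrow> None | Some k \<Rightarrow> u k x)"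
    proof (rule continuous_map_scheduled)
      show "open {t. ph i t = Some k}" for k using ph i unfolding schedule_def by blast
      show "continuous_map X (indiscrete_cone ?A) (u k)" if "ph i t = Some k" for t k
      proof (cases k)
        case (Pair b j)
        then have "j \<in> I" using ph i that by (auto simp: schedule_def)
        then show ?thesis using f_cont Pair by (simp add: u_def)
      qed
    qed
    moreover have "(\<lambda>y. h y i) = (\<lambda>(x, t). case ph i t of None \<Rightarrow> None | Some k \<Rightarrow> u k x)"
      using i by (auto simp: h_def)
    ultimately show "continuous_map ?Y (indiscrete_cone ?A) (\<lambda>y. h y i)" by simp
  next
    fix y assume "y \<in> topspace ?Y"
    then obtain x t where y: "y = (x, t)" and x: "x \<in> topspace X" by auto
    obtain b where b: "\<forall>j\<in>I. \<exists>i\<in>I. ph i t = Some (b, j)"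
      using ph unfolding schedule_def by blast
    obtain j where "j \<in> I" "f b x j \<noteq> None" using f_nz[OF x] by blast
    moreover from this obtain i where "i \<in> I" "ph i t = Some (b, j)" using b by blast
    ultimately have "h y i \<noteq> None" by (simp add: y h_def u_def)
    then show "\<exists>i\<in>I. h y i \<noteq> None" using \<open>i \<in> I\<close> by blast
  qed
  moreover have "equivariant G ?Y ?a (E_act G I) h"
  proof -
    have "h (a x g, t) i = E_act G I (h (x, t)) g i"
      if "x \<in> topspace X" "g \<in> carrier G" for x t g i
    proof (cases "i \<in> I \<and> (\<exists>b j. ph i t = Some (b, j))")
      case True
      then obtain b j where i: "i \<in> I" "ph i t = Some (b, j)" by blast
      then have "j \<in> I" using ph by (auto simp: schedule_def)
      then show ?thesis using i f_eq that by (simp add: h_def u_def E_act_def)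
    next
      case False
      then have "i \<notin> I \<or> ph i t = None" by (cases "ph i t") auto
      then show ?thesis by (auto simp: h_def E_act_def cone_act_def)
    qed
    then show ?thesis by (auto simp: equivariant_def)
  qed
  moreover have "h (x, -1) = f False x \<and> h (x, 1) = f True x" if "x \<in> topspace X" for x
  proof -
    have "f b x \<in> extensional I" for b using f_ext that by blast
    then have "f b x i = undefined" if "i \<notin> I" for b i using that by (simp add: extensional_def)
    then show ?thesis using ph by (auto simp: h_def u_def schedule_def fun_eq_iff)
  qed
  ultimately show ?thesis unfolding G_homotopic_def G_map_def by blast
qed


section \<open>Coset spaces\<close>

lemma topological_group_imp_group: "topological_group G \<tau> \<Longrightarrow> group G"
  by (simp add: topological_group_def)

lemma topspace_topological_group: "topological_group G \<tau> \<Longrightarrow> topspace \<tau> = carrier G"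
  by (simp add: topological_group_def)

lemma continuous_map_left_translation:
  assumes "topological_group G \<tau>" "g \<in> carrier G"
  shows "continuous_map \<tau> \<tau> (\<lambda>x. g \<otimes>\<^bsub>G\<^esub> x)"
proof -
  have "continuous_map \<tau> (prod_topology \<tau> \<tau>) (\<lambda>x. (g, x))"
    using assms by (simp add: continuous_map_pairwise o_def topological_group_def)
  moreover have "continuous_map (prod_topology \<tau> \<tau>) \<tau> (\<lambda>(x, y). x \<otimes>\<^bsub>G\<^esub> y)"
    using assms by (simp add: topological_group_def)
  ultimately show ?thesis by (auto dest: continuous_map_compose simp: o_def)
qed

lemma rcos_eq_iff:
  assumes "group G" "subgroup H G" "x \<in> carrier G" "y \<in> carrier G"
  shows "H #>\<^bsub>G\<^esub> x = H #>\<^bsub>G\<^esub> y \<longleftrightarrow> (\<exists>h\<in>H. x = h \<otimes>\<^bsub>G\<^esub> y)"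
proof
  interpret group G by fact
  assume "H #>\<^bsub>G\<^esub> x = H #>\<^bsub>G\<^esub> y"
  then have "x \<in> H #>\<^bsub>G\<^esub> y" using rcos_self[OF assms(3,2)] by simp
  then show "\<exists>h\<in>H. x = h \<otimes>\<^bsub>G\<^esub> y" by (auto simp: r_coset_def)
next
  interpret group G by fact
  assume "\<exists>h\<in>H. x = h \<otimes>\<^bsub>G\<^esub> y"
  then have "x \<in> H #>\<^bsub>G\<^esub> y" by (auto simp: r_coset_def)
  then show "H #>\<^bsub>G\<^esub> x = H #>\<^bsub>G\<^esub> y" using repr_independence assms by metis
qed

lemma rcos_translate:
  assumes "group G" "subgroup H G" "x \<in> carrier G" "g \<in> carrier G"
  shows "(H #>\<^bsub>G\<^esub> x) #>\<^bsub>G\<^esub> g = H #>\<^bsub>G\<^esub> (x \<otimes>\<^bsub>G\<^esub> g)"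
  using assms by (simp add: group.coset_mult_assoc subgroup.subset)

text \<open>The saturation of an open set \<open>U\<close> is the union of its translates \<open>hU\<close>, hence open.\<close>

lemma open_map_coset_space:
  assumes G: "topological_group G \<tau>" and H: "subgroup H G"
  shows "open_map \<tau> (coset_space G \<tau> H) (\<lambda>g. H #>\<^bsub>G\<^esub> g)"
  unfolding open_map_def
proof (intro allI impI)
  interpret group G using G by (rule topological_group_imp_group)
  interpret H: subgroup H G by (rule H)
  note top = topspace_topological_group[OF G]
  fix U assume U: "openin \<tau> U"
  then have UG: "U \<subseteq> carrier G" using openin_subset top by blast
  have "openin \<tau> {x \<in> topspace \<tau>. inv\<^bsub>G\<^esub> h \<otimes>\<^bsub>G\<^esub> x \<in> U}" if "h \<in> H" for h
    using openin_continuous_map_preimage[OF continuous_map_left_translation[OF G] U] that by simp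
  then have "openin \<tau> (\<Union>h\<in>H. {x \<in> topspace \<tau>. inv\<^bsub>G\<^esub> h \<otimes>\<^bsub>G\<^esub> x \<in> U})" by blast
  moreover have "{x \<in> topspace \<tau>. H #>\<^bsub>G\<^esub> x \<in> (\<lambda>g. H #>\<^bsub>G\<^esub> g) ` U} =
      (\<Union>h\<in>H. {x \<in> topspace \<tau>. inv\<^bsub>G\<^esub> h \<otimes>\<^bsub>G\<^esub> x \<in> U})" (is "?L = ?R")
  proof (intro equalityI subsetI)
    fix x assume "x \<in> ?L"
    then obtain u where x: "x \<in> carrier G" and u: "u \<in> U" "H #>\<^bsub>G\<^esub> x = H #>\<^bsub>G\<^esub> u"
      using top by auto
    then obtain h where h: "h \<in> H" "x = h \<otimes>\<^bsub>G\<^esub> u"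
      using rcos_eq_iff[OF is_group H] UG by blast
    then have "inv\<^bsub>G\<^esub> h \<otimes>\<^bsub>G\<^esub> x = u" using u(1) UG by (auto simp: m_assoc[symmetric])
    then show "x \<in> ?R" using u(1) x top by (intro UN_I[OF h(1)]) simp
  next
    fix x assume "x \<in> ?R"
    then obtain h where x: "x \<in> carrier G" and h: "h \<in> H" "inv\<^bsub>G\<^esub> h \<otimes>\<^bsub>G\<^esub> x \<in> U"
      using top by auto
    then have "x = h \<otimes>\<^bsub>G\<^esub> (inv\<^bsub>G\<^esub> h \<otimes>\<^bsub>G\<^esub> x)" by (simp add: m_assoc[symmetric])
    then have "H #>\<^bsub>G\<^esub> x = H #>\<^bsub>G\<^esub> (inv\<^bsub>G\<^esub> h \<otimes>\<^bsub>G\<^esub> x)"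
      using rcos_eq_iff[OF is_group H x] h UG by blast
    then show "x \<in> ?L" using x h top by blast
  qed
  ultimately have "openin \<tau> {x \<in> topspace \<tau>. H #>\<^bsub>G\<^esub> x \<in> (\<lambda>g. H #>\<^bsub>G\<^esub> g) ` U}" by simp
  then show "openin (coset_space G \<tau> H) ((\<lambda>g. H #>\<^bsub>G\<^esub> g) ` U)"
    using UG top by (auto simp: coset_space_def openin_quotient_topology)
qed

lemma openin_cosets_sum:
  assumes "topological_group G \<tau>"
  shows "openin (cosets_sum G \<tau> F) U \<longleftrightarrow>
    U \<subseteq> {(H, H #>\<^bsub>G\<^esub> x) | H x. H \<in> F \<and> x \<in> carrier G} \<and>
    (\<forall>H\<in>F. openin \<tau> {x \<in> carrier G. (H, H #>\<^bsub>G\<^esub> x) \<in> U})"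
  unfolding cosets_sum_def openin_sum_topology coset_space_def openin_quotient_topology
    topspace_quotient_topology o_def topspace_topological_group[OF assms]
  by (auto 0 3)

lemma topspace_cosets_sum:
  assumes "topological_group G \<tau>"
  shows "topspace (cosets_sum G \<tau> F) = {(H, H #>\<^bsub>G\<^esub> x) | H x. H \<in> F \<and> x \<in> carrier G}"
  by (auto simp: cosets_sum_def coset_space_def topspace_quotient_topology
      topspace_topological_group[OF assms])

text \<open>A product of quotient maps need not be a quotient map, so continuity of the action does not
  follow formally from that of the multiplication. It does here because the maps \<open>G \<rightarrow> H\G\<close> are open: a
  box around \<open>(x, g)\<close> in \<open>G \<times> G\<close> has an open image in \<open>H\G \<times> G\<close>.\<close>

lemma right_space_cosets_sum:
  assumes G: "topological_group G \<tau>" and F: "\<And>H. H \<in> F \<Longrightarrow> subgroup H G"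
  shows "right_space G \<tau> (cosets_sum G \<tau> F) (cosets_sum_act G)"
  unfolding right_space_def
proof (intro conjI ballI)
  interpret group G using G by (rule topological_group_imp_group)
  let ?A = "cosets_sum G \<tau> F"
  note top = topspace_topological_group[OF G]
  have act: "cosets_sum_act G (H, H #>\<^bsub>G\<^esub> x) g = (H, H #>\<^bsub>G\<^esub> (x \<otimes>\<^bsub>G\<^esub> g))"
    if "H \<in> F" "x \<in> carrier G" "g \<in> carrier G" for H x g
    using that by (simp add: cosets_sum_act_def rcos_translate[OF is_group F])
  show "cosets_sum_act G p \<one>\<^bsub>G\<^esub> = p" if "p \<in> topspace ?A" for p
    using that act by (auto simp: topspace_cosets_sum[OF G])
  show "cosets_sum_act G (cosets_sum_act G p g) h = cosets_sum_act G p (g \<otimes>\<^bsub>G\<^esub> h)"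
    if "p \<in> topspace ?A" "g \<in> carrier G" "h \<in> carrier G" for p g h
    using that act by (auto simp: topspace_cosets_sum[OF G] m_assoc)
  show "continuous_map (prod_topology ?A \<tau>) ?A (\<lambda>(p, g). cosets_sum_act G p g)"
    unfolding continuous_map_def
  proof (intro conjI allI impI)
    show "(\<lambda>(p, g). cosets_sum_act G p g) \<in> topspace (prod_topology ?A \<tau>) \<rightarrow> topspace ?A"
      using act by (auto simp: topspace_cosets_sum[OF G] top) (metis m_closed)
    fix V assume V: "openin ?A V"
    let ?W = "{z \<in> topspace (prod_topology ?A \<tau>). (\<lambda>(p, g). cosets_sum_act G p g) z \<in> V}"
    show "openin (prod_topology ?A \<tau>) ?W"
      unfolding openin_prod_topology_alt
    proof (intro allI impI)
      fix p g assume pg: "(p, g) \<in> ?W"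
      then obtain H x where H: "H \<in> F" and x: "x \<in> carrier G" and p: "p = (H, H #>\<^bsub>G\<^esub> x)"
        and g: "g \<in> carrier G" by (auto simp: topspace_cosets_sum[OF G] top)
      have VH: "openin \<tau> {y \<in> carrier G. (H, H #>\<^bsub>G\<^esub> y) \<in> V}" (is "openin \<tau> ?V")
        using V H by (simp add: openin_cosets_sum[OF G])
      have "continuous_map (prod_topology \<tau> \<tau>) \<tau> (\<lambda>(x, y). x \<otimes>\<^bsub>G\<^esub> y)"
        using G by (simp add: topological_group_def)
      define Q where "Q = {z \<in> topspace (prod_topology \<tau> \<tau>). (\<lambda>(x, y). x \<otimes>\<^bsub>G\<^esub> y) z \<in> ?V}"
      have "openin (prod_topology \<tau> \<tau>) Q"
        unfolding Q_def by (rule openin_continuous_map_preimage) fact+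
      moreover have "(x, g) \<in> Q" using pg x g top by (simp add: Q_def p act[OF H])
      ultimately obtain N M where N: "openin \<tau> N" "x \<in> N" and M: "openin \<tau> M" "g \<in> M"
        and NM: "N \<times> M \<subseteq> Q"
        unfolding openin_prod_topology_alt by blast
      let ?N = "Pair H ` (\<lambda>y. H #>\<^bsub>G\<^esub> y) ` N"
      have "openin (coset_space G \<tau> H) ((\<lambda>y. H #>\<^bsub>G\<^esub> y) ` N)"
        using open_map_coset_space[OF G F[OF H]] N(1) by (simp add: open_map_def)
      then have "openin ?A ?N"
        using open_map_component_injection[OF H] unfolding cosets_sum_def open_map_def by blast
      moreover have "p \<in> ?N" using N(2) p by blast
      moreover have "?N \<times> M \<subseteq> ?W"
      proof
        fix z assume "z \<in> ?N \<times> M"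
        then obtain y m where z: "z = ((H, H #>\<^bsub>G\<^esub> y), m)" and y: "y \<in> N" and m: "m \<in> M" by blast
        have "(y, m) \<in> Q" using NM y m by blast
        then have "y \<in> carrier G" "m \<in> carrier G" "(H, H #>\<^bsub>G\<^esub> (y \<otimes>\<^bsub>G\<^esub> m)) \<in> V"
          using top by (auto simp: Q_def)
        then show "z \<in> ?W"
          using H by (auto simp: z top topspace_cosets_sum[OF G] act[OF H])
      qed
      ultimately show "\<exists>U V. openin ?A U \<and> openin \<tau> V \<and> p \<in> U \<and> g \<in> V \<and> U \<times> V \<subseteq> ?W"
        using M by blast
    qed
  qed
qed

lemma continuous_map_cone_act:
  assumes "continuous_map (prod_topology A \<tau>) A (\<lambda>(x, g). a x g)"
  shows "continuous_map (prod_topology (indiscrete_cone A) \<tau>) (indiscrete_cone A)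
    (\<lambda>(x, g). cone_act a x g)"
  unfolding continuous_map_indiscrete_cone
proof (intro conjI allI impI)
  let ?C = "indiscrete_cone A"
  have mem: "a x g \<in> topspace A" if "x \<in> topspace A" "g \<in> topspace \<tau>" for x g
    using funcset_mem[OF continuous_map_funspace[OF assms], of "(x, g)"] that by simp
  show "(\<lambda>(x, g). cone_act a x g) \<in> topspace (prod_topology ?C \<tau>) \<rightarrow> insert None (Some ` topspace A)"
    using mem by (auto simp: topspace_indiscrete_cone cone_act_def)
  fix V assume V: "openin A V"
  let ?W = "{z \<in> topspace (prod_topology A \<tau>). (\<lambda>(x, g). a x g) z \<in> V}"
  have W: "openin (prod_topology A \<tau>) ?W"
    using openin_continuous_map_preimage[OF assms V] .
  have "openin (prod_topology ?C \<tau>) ((\<lambda>(x, g). (Some x, g)) ` ?W)" (is "openin _ ?SW")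
    unfolding openin_prod_topology_alt
  proof (intro allI impI)
    fix c g assume "(c, g) \<in> ?SW"
    then obtain x where c: "c = Some x" and xg: "(x, g) \<in> ?W" by (elim imageE) auto
    from W xg obtain U N where U: "openin A U" "x \<in> U" and N: "openin \<tau> N" "g \<in> N"
      and UN: "U \<times> N \<subseteq> ?W"
      unfolding openin_prod_topology_alt by blast
    have "openin ?C (Some ` U)" using U by (auto simp: openin_indiscrete_cone)
    moreover have "Some ` U \<times> N = (\<lambda>(x, g). (Some x, g)) ` (U \<times> N)" by force
    then have "Some ` U \<times> N \<subseteq> ?SW" using UN by (simp add: image_mono)
    ultimately show "\<exists>U V. openin ?C U \<and> openin \<tau> V \<and> c \<in> U \<and> g \<in> V \<and> U \<times> V \<subseteq> ?SW"
      using U(2) N c by blast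
  qed
  moreover have "{z \<in> topspace (prod_topology ?C \<tau>). (\<lambda>(x, g). cone_act a x g) z \<in> Some ` V} =
      (\<lambda>(x, g). (Some x, g)) ` ?W" (is "?L = ?R")
  proof (intro equalityI subsetI)
    fix z assume z: "z \<in> ?L"
    obtain c g where c: "z = (c, g)" by (cases z)
    then obtain x where "c = Some x" using z by (cases c) (auto simp: cone_act_def)
    then have "z = (\<lambda>(x, g). (Some x, g)) (x, g)" "(x, g) \<in> ?W"
      using z c by (auto simp: topspace_indiscrete_cone cone_act_def)
    then show "z \<in> ?R" by (rule image_eqI)
  next
    fix z assume "z \<in> ?R"
    then show "z \<in> ?L" by (auto simp: topspace_indiscrete_cone cone_act_def)
  qed
  ultimately show "openin (prod_topology ?C \<tau>)
      {z \<in> topspace (prod_topology ?C \<tau>). (\<lambda>(x, g). cone_act a x g) z \<in> Some ` V}" by simp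
qed

lemma right_space_E_space:
  assumes G: "topological_group G \<tau>" and F: "\<And>H. H \<in> F \<Longrightarrow> subgroup H G"
  shows "right_space G \<tau> (E_space G \<tau> F I) (E_act G I)"
proof -
  let ?E = "E_space G \<tau> F I" and ?A = "cosets_sum G \<tau> F"
  have A: "right_space G \<tau> ?A (cosets_sum_act G)" by (rule right_space_cosets_sum[OF G F])
  have ext: "e \<in> extensional I" and comp: "i \<in> I \<Longrightarrow> e i \<in> insert None (Some ` topspace ?A)"
    if "e \<in> topspace ?E" for e i
    using that by (auto simp: topspace_E_space PiE_def)
  have "continuous_map (prod_topology ?E \<tau>) ?E (\<lambda>(e, g). E_act G I e g)"
    unfolding continuous_map_E_space
  proof (intro conjI ballI)
    show "(\<lambda>(e, g). E_act G I e g) \<in> topspace (prod_topology ?E \<tau>) \<rightarrow> extensional I"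
      by (auto simp: E_act_def)
  next
    fix i assume i: "i \<in> I"
    have "continuous_map (prod_topology ?E \<tau>) (prod_topology (indiscrete_cone ?A) \<tau>)
        (\<lambda>(e, g). (e i, g))"
      using continuous_map_compose[OF continuous_map_fst continuous_map_E_space_component[OF i]]
      by (auto simp: continuous_map_pairwise o_def case_prod_unfold continuous_map_snd)
    moreover have "continuous_map (prod_topology (indiscrete_cone ?A) \<tau>) (indiscrete_cone ?A)
        (\<lambda>(x, g). cone_act (cosets_sum_act G) x g)"
      using A by (intro continuous_map_cone_act) (simp add: right_space_def)
    ultimately have "continuous_map (prod_topology ?E \<tau>) (indiscrete_cone ?A)
        ((\<lambda>(x, g). cone_act (cosets_sum_act G) x g) \<circ> (\<lambda>(e, g). (e i, g)))"
      by (rule continuous_map_compose)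
    moreover have "(\<lambda>(x, g). cone_act (cosets_sum_act G) x g) \<circ> (\<lambda>(e, g). (e i, g)) =
        (\<lambda>y. (case y of (e, g) \<Rightarrow> E_act G I e g) i)"
      using i by (auto simp: E_act_def)
    ultimately show "continuous_map (prod_topology ?E \<tau>) (indiscrete_cone ?A)
        (\<lambda>y. (case y of (e, g) \<Rightarrow> E_act G I e g) i)" by simp
  next
    fix y assume y: "y \<in> topspace (prod_topology ?E \<tau>)"
    obtain e g where eg: "y = (e, g)" by (cases y)
    then obtain i where "i \<in> I" "e i \<noteq> None" using y by (auto simp: topspace_E_space)
    then show "\<exists>i\<in>I. (case y of (e, g) \<Rightarrow> E_act G I e g) i \<noteq> None"
      by (intro bexI[of _ i]) (auto simp: eg E_act_def cone_act_def)
  qed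
  moreover have "E_act G I e \<one>\<^bsub>G\<^esub> = e" if "e \<in> topspace ?E" for e
  proof (rule extensionalityI[OF _ ext[OF that]])
    show "E_act G I e \<one>\<^bsub>G\<^esub> \<in> extensional I" by (simp add: E_act_def)
    show "E_act G I e \<one>\<^bsub>G\<^esub> i = e i" if i: "i \<in> I" for i
      using comp[OF \<open>e \<in> topspace ?E\<close> i] A i by (auto simp: E_act_def cone_act_def right_space_def)
  qed
  moreover have "E_act G I (E_act G I e g) h = E_act G I e (g \<otimes>\<^bsub>G\<^esub> h)"
    if e: "e \<in> topspace ?E" and gh: "g \<in> carrier G" "h \<in> carrier G" for e g h
  proof (rule extensionalityI[where A = I])
    show "E_act G I (E_act G I e g) h i = E_act G I e (g \<otimes>\<^bsub>G\<^esub> h) i" if i: "i \<in> I" for i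
      using comp[OF e i] A i gh by (auto simp: E_act_def cone_act_def right_space_def)
  qed (simp_all add: E_act_def)
  ultimately show ?thesis unfolding right_space_def by blast
qed

section \<open>Tubes and maps to coset spaces\<close>

text \<open>The map is \<open>[s, g] \<mapsto> Hg\<close>, which is well defined as \<open>(sh, g)\<close> and \<open>(s, hg)\<close> have the same coset
  \<open>Hg = Hhg\<close>.\<close>

lemma tube_imp_map_to_coset_space:
  fixes X :: "'x topology"
  assumes G: "topological_group G \<tau>" and F: "\<And>H. H \<in> F \<Longrightarrow> subgroup H G"
    and T: "tube G \<tau> F X a T"
  shows "\<exists>H\<in>F. \<exists>p. continuous_map (subtopology X T) (coset_space G \<tau> H) p \<and>
    (\<forall>x\<in>T. \<forall>g\<in>carrier G. p (a x g) = p x #>\<^bsub>G\<^esub> g)"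
proof -
  interpret group G using G by (rule topological_group_imp_group)
  note top = topspace_topological_group[OF G]
  obtain H and S :: "'x topology" and b f where HF: "H \<in> F"
    and S: "right_space (G\<lparr>carrier := H\<rparr>) (subtopology \<tau> H) S b"
    and hf: "homeomorphic_map (subtopology X T) (balanced_product G \<tau> H S b) f"
    and ef: "equivariant G (subtopology X T) a (balanced_act G) f"
    using T unfolding tube_def by blast
  let ?R = "balanced_rel G H S b" and ?B = "balanced_product G \<tau> H S b"
  note HG = F[OF HF]
  have XT: "topspace (subtopology X T) = T" and inv: "\<And>x g. x \<in> T \<Longrightarrow> g \<in> carrier G \<Longrightarrow> a x g \<in> T"
    using T openin_subset[of X T] by (auto simp: tube_def)
  have eqv: "equiv (topspace S \<times> carrier G) ?R" by (rule equiv_balanced_rel[OF G HG S])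
  have snd_R: "H #>\<^bsub>G\<^esub> g' = H #>\<^bsub>G\<^esub> g" if "((s, g), (s', g')) \<in> ?R" for s g s' g'
  proof -
    have "\<exists>h\<in>H. g' = h \<otimes>\<^bsub>G\<^esub> g" "g \<in> carrier G" "g' \<in> carrier G"
      using that HG by (auto simp: balanced_rel_def subgroup.mem_carrier)
    then show ?thesis using rcos_eq_iff[OF is_group HG] by blast
  qed
  define r where "r C = H #>\<^bsub>G\<^esub> snd (SOME z. z \<in> C)" for C :: "('x \<times> 'a) set"
  have B: "topspace ?B = (\<lambda>p. ?R `` {p}) ` (topspace S \<times> carrier G)"
    by (simp add: balanced_product_def topspace_quotient_topology top)
  have r: "r C = H #>\<^bsub>G\<^esub> g" if C: "C \<in> topspace ?B" and sg: "(s, g) \<in> C" for C s g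
  proof -
    obtain z where z: "C = ?R `` {z}" using C B by blast
    obtain s' g' where some: "(SOME z. z \<in> C) = (s', g')" by (rule prod.exhaust)
    have "(s', g') \<in> C" using sg someI[of "\<lambda>z. z \<in> C" "(s, g)"] some by simp
    then have "(z, (s', g')) \<in> ?R" "(z, (s, g)) \<in> ?R" using sg by (simp_all add: z)
    then have "((s, g), (s', g')) \<in> ?R" using eqv by (meson equivE symE transE)
    then show ?thesis by (simp add: r_def some snd_R)
  qed
  have mem: "(s, g) \<in> ?R `` {(s, g)}" "?R `` {(s, g)} \<in> topspace ?B"
    if "s \<in> topspace S" "g \<in> carrier G" for s g
    using equiv_class_self[OF eqv] that B by auto
  have r_class: "r (?R `` {(s, g)}) = H #>\<^bsub>G\<^esub> g" if "s \<in> topspace S" "g \<in> carrier G" for s g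
    using r[OF mem(2)[OF that] mem(1)[OF that]] .
  have "continuous_map ?B (coset_space G \<tau> H) r"
  proof (rule continuous_compose_quotient_map)
    show "quotient_map (prod_topology S \<tau>) ?B (\<lambda>p. ?R `` {p})"
      unfolding balanced_product_def by (rule quotient_map_quotient_topology)
    have "continuous_map \<tau> (coset_space G \<tau> H) (\<lambda>g. H #>\<^bsub>G\<^esub> g)"
      unfolding coset_space_def
      by (rule quotient_imp_continuous_map[OF quotient_map_quotient_topology])
    from continuous_map_compose[OF continuous_map_snd this]
    show "continuous_map (prod_topology S \<tau>) (coset_space G \<tau> H) (r \<circ> (\<lambda>p. ?R `` {p}))"
      by (rule continuous_map_eq) (use r_class top in \<open>auto simp: o_def\<close>)
  qed
  with hf have "continuous_map (subtopology X T) (coset_space G \<tau> H) (r \<circ> f)"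
    using continuous_map_compose homeomorphic_imp_continuous_map by blast
  moreover have "(r \<circ> f) (a x k) = (r \<circ> f) x #>\<^bsub>G\<^esub> k" if x: "x \<in> T" and k: "k \<in> carrier G" for x k
  proof -
    have fB: "f y \<in> topspace ?B" if "y \<in> T" for y
      using homeomorphic_imp_surjective_map[OF hf] that XT by blast
    obtain s g where fx: "f x = ?R `` {(s, g)}" and s: "s \<in> topspace S" and g: "g \<in> carrier G"
      using fB[OF x] B by auto
    then have sg: "(s, g) \<in> f x" using mem by simp
    then have "(s, g \<otimes>\<^bsub>G\<^esub> k) \<in> balanced_act G (f x) k"
      unfolding balanced_act_def by (rule rev_image_eqI) simp
    then have "(s, g \<otimes>\<^bsub>G\<^esub> k) \<in> f (a x k)"
      using ef x k XT by (simp add: equivariant_def)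
    then show ?thesis
      using r[OF fB[OF x] sg] r[OF fB[OF inv[OF x k]]] rcos_translate[OF is_group HG g k] by simp
  qed
  ultimately show ?thesis using HF by blast
qed

text \<open>Let \<open>S\<close> be the fibre of \<open>p\<close> over the coset \<open>K\<close>. The classes of the balanced product are exactly the
  fibres of the action map \<open>m : S \<times> G \<rightarrow> T\<close>: if \<open>sg = s'g'\<close>, applying \<open>p\<close> gives \<open>Kg = Kg'\<close>. So \<open>S \<times>\<^sub>K G \<rightarrow> T\<close> is a
  continuous bijection, and the point is that it is a homeomorphism, for which \<open>m\<close> has to be a quotient
  map. In fact \<open>m\<close> is open. Near \<open>x = sg\<close> a preimage of \<open>y\<close> close to \<open>(s, g)\<close> is \<open>(yk\<^sup>-\<^sup>1, k)\<close>, for any \<open>k\<close>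
  close to \<open>g\<close> with \<open>p y = Kk\<close>; such a \<open>k\<close> exists for all \<open>y\<close> near \<open>x\<close> because \<open>G \<rightarrow> K\G\<close> is open.\<close>

lemma tube_if_map_to_coset_space:
  fixes X :: "'x topology"
  assumes G: "topological_group G \<tau>" and X: "right_space G \<tau> X a"
    and KF: "K \<in> F" and K: "subgroup K G"
    and T: "openin X T" and inv: "\<And>x g. x \<in> T \<Longrightarrow> g \<in> carrier G \<Longrightarrow> a x g \<in> T"
    and p: "continuous_map (subtopology X T) (coset_space G \<tau> K) p"
    and p_eq: "\<And>x g. x \<in> T \<Longrightarrow> g \<in> carrier G \<Longrightarrow> p (a x g) = p x #>\<^bsub>G\<^esub> g"
  shows "tube G \<tau> F X a T"
proof -
  interpret group G using G by (rule topological_group_imp_group)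
  interpret K: subgroup K G by (rule K)
  note top = topspace_topological_group[OF G]
  have TX: "T \<subseteq> topspace X" using T by (rule openin_subset)
  have a_cont: "continuous_map (prod_topology X \<tau>) X (\<lambda>(x, g). a x g)"
    and a_one: "\<And>x. x \<in> T \<Longrightarrow> a x \<one>\<^bsub>G\<^esub> = x"
    and a_mult: "\<And>x g h. x \<in> T \<Longrightarrow> g \<in> carrier G \<Longrightarrow> h \<in> carrier G \<Longrightarrow>
      a (a x g) h = a x (g \<otimes>\<^bsub>G\<^esub> h)"
    using X TX by (auto simp: right_space_def)
  have p_ex: "\<exists>g\<in>carrier G. p x = K #>\<^bsub>G\<^esub> g" if "x \<in> T" for x
    using funcset_mem[OF continuous_map_funspace[OF p], of x] that TX top
    by (auto simp: coset_space_def topspace_quotient_topology)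
  define S\<^sub>0 where "S\<^sub>0 = {x \<in> T. p x = K}"
  define S where "S = subtopology X S\<^sub>0"
  have S: "topspace S = S\<^sub>0" using TX by (auto simp: S_def S\<^sub>0_def)
  have ST: "s \<in> T" if "s \<in> S\<^sub>0" for s using that by (simp add: S\<^sub>0_def)
  have K1: "K #>\<^bsub>G\<^esub> \<one>\<^bsub>G\<^esub> = K" using coset_mult_one K.subset by blast
  have pS: "p (a s g) = K #>\<^bsub>G\<^esub> g" if "s \<in> S\<^sub>0" "g \<in> carrier G" for s g
    using that p_eq by (simp add: S\<^sub>0_def)
  have S_inv: "a s k \<in> S\<^sub>0" if s: "s \<in> S\<^sub>0" and k: "k \<in> K" for s k
  proof -
    have kG: "k \<in> carrier G" using k by simp
    then have "p (a s k) = K" using pS[OF s kG] coset_join2[OF kG K k] by simp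
    then show ?thesis using inv[OF ST[OF s] kG] by (simp add: S\<^sub>0_def)
  qed
  have S_back: "a x (inv\<^bsub>G\<^esub> g) \<in> S\<^sub>0" if "x \<in> T" "g \<in> carrier G" "p x = K #>\<^bsub>G\<^esub> g" for x g
    using that p_eq[of x "inv\<^bsub>G\<^esub> g"] inv rcos_translate[OF is_group K, of g "inv\<^bsub>G\<^esub> g"] K1
    by (simp add: S\<^sub>0_def)
  have S_space: "right_space (G\<lparr>carrier := K\<rparr>) (subtopology \<tau> K) S a"
  proof -
    have "continuous_map (prod_topology S (subtopology \<tau> K)) X (\<lambda>(x, g). a x g)"
      unfolding S_def prod_topology_subtopology subtopology_subtopology
      by (rule continuous_map_from_subtopology[OF a_cont])
    then have "continuous_map (prod_topology S (subtopology \<tau> K)) S (\<lambda>(x, g). a x g)"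
      using S_inv S by (auto simp: S_def continuous_map_in_subtopology)
    then show ?thesis
      using a_one a_mult S ST by (auto simp: right_space_def)
  qed
  let ?R = "balanced_rel G K S a" and ?B = "balanced_product G \<tau> K S a"
  let ?m = "\<lambda>(s, g). a s g"
  \<comment> \<open>The inverse of \<open>[s, g] \<mapsto> sg\<close>.\<close>
  define f where "f x = {(s, g). s \<in> S\<^sub>0 \<and> g \<in> carrier G \<and> a s g = x}" for x
  have f: "?R `` {(s, g)} = f (a s g)" if s: "s \<in> S\<^sub>0" and g: "g \<in> carrier G" for s g
  proof (intro equalityI subsetI)
    fix z assume "z \<in> ?R `` {(s, g)}"
    then obtain s' k where "s = a s' k" "z = (s', k \<otimes>\<^bsub>G\<^esub> g)" "s' \<in> S\<^sub>0" "k \<in> K"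
      by (auto simp: balanced_rel_def S)
    then show "z \<in> f (a s g)" using a_mult ST g by (simp add: f_def)
  next
    fix z assume "z \<in> f (a s g)"
    then obtain s' g' where z: "z = (s', g')" and s': "s' \<in> S\<^sub>0" and g': "g' \<in> carrier G"
      and eq: "a s' g' = a s g" by (auto simp: f_def)
    then have "K #>\<^bsub>G\<^esub> g' = K #>\<^bsub>G\<^esub> g" using pS s g by metis
    then obtain k where k: "k \<in> K" "g' = k \<otimes>\<^bsub>G\<^esub> g"
      using rcos_eq_iff[OF is_group K g' g] by blast
    have "a (a s' (k \<otimes>\<^bsub>G\<^esub> g)) (inv\<^bsub>G\<^esub> g) = a (a s g) (inv\<^bsub>G\<^esub> g)" using eq k by simp
    then have "a s' k = s"
      using a_mult a_one ST s s' g k(1) by (simp add: m_assoc)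
    then have "((s, g), (s', g')) \<in> ?R"
      unfolding balanced_rel_def k(2) using s' k(1) g S by blast
    then show "z \<in> ?R `` {(s, g)}" by (simp add: z)
  qed
  have m_open: "open_map (prod_topology S \<tau>) (subtopology X T) ?m"
    unfolding open_map_def
  proof (intro allI impI)
    fix W assume W: "openin (prod_topology S \<tau>) W"
    have "prod_topology S \<tau> = subtopology (prod_topology X \<tau>) (S\<^sub>0 \<times> topspace \<tau>)"
      by (simp add: S_def prod_topology_subtopology)
    then obtain W' where W': "openin (prod_topology X \<tau>) W'" and WW': "W = W' \<inter> S\<^sub>0 \<times> topspace \<tau>"
      using W by (auto simp: openin_subtopology)
    have "openin X (?m ` W)"
    proof (subst openin_subopen, intro ballI)
      fix x assume "x \<in> ?m ` W"
      then obtain s g where sg: "(s, g) \<in> W" and x: "x = a s g" by auto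
      have s: "s \<in> S\<^sub>0" and g: "g \<in> carrier G"
        using sg openin_subset[OF W] S top by auto
      have xT: "x \<in> T" using x s g inv ST by simp
      let ?\<theta> = "\<lambda>(y, k). (a y (inv\<^bsub>G\<^esub> k), k)"
      have "continuous_map (prod_topology X \<tau>) (prod_topology X \<tau>) (\<lambda>(y, k). (y, inv\<^bsub>G\<^esub> k))"
      proof -
        have "continuous_map \<tau> \<tau> (\<lambda>k. inv\<^bsub>G\<^esub> k)" using G by (simp add: topological_group_def)
        from continuous_map_compose[OF continuous_map_snd this] show ?thesis
          by (auto simp: continuous_map_pairwise o_def case_prod_unfold continuous_map_fst)
      qed
      from continuous_map_compose[OF this a_cont]
      have "continuous_map (prod_topology X \<tau>) (prod_topology X \<tau>) ?\<theta>"
        by (auto simp: continuous_map_pairwise o_def case_prod_unfold continuous_map_snd)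
      from openin_continuous_map_preimage[OF this W']
      have "openin (prod_topology X \<tau>) {z \<in> topspace (prod_topology X \<tau>). ?\<theta> z \<in> W'}"
        (is "openin _ ?Q") .
      moreover have "(x, g) \<in> ?Q"
        using x xT TX g top sg WW' s ST a_mult a_one by auto
      ultimately obtain B N where B: "openin X B" "x \<in> B" and N: "openin \<tau> N" "g \<in> N"
        and BN: "B \<times> N \<subseteq> ?Q"
        unfolding openin_prod_topology_alt by blast
      let ?U = "{y \<in> T. p y \<in> (\<lambda>k. K #>\<^bsub>G\<^esub> k) ` N}"
      have "openin (coset_space G \<tau> K) ((\<lambda>k. K #>\<^bsub>G\<^esub> k) ` N)"
        using open_map_coset_space[OF G K] N(1) by (simp add: open_map_def)
      from openin_continuous_map_preimage[OF p this]
      have "openin X ?U" using T TX by (simp add: openin_open_subtopology Int_absorb1)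
      then have "openin X (B \<inter> ?U)" using B(1) by blast
      moreover have "x \<in> B \<inter> ?U" using B(2) xT N(2) pS[OF s g] x by blast
      moreover have "B \<inter> ?U \<subseteq> ?m ` W"
      proof
        fix y assume "y \<in> B \<inter> ?U"
        then obtain k where y: "y \<in> B" "y \<in> T" and k: "k \<in> N" "p y = K #>\<^bsub>G\<^esub> k" by blast
        have kG: "k \<in> carrier G" using openin_subset[OF N(1)] k top by blast
        have "(y, k) \<in> ?Q" using BN y k by blast
        then have "(a y (inv\<^bsub>G\<^esub> k), k) \<in> W"
          using S_back[OF y(2) kG k(2)] by (auto simp: WW')
        moreover have "?m (a y (inv\<^bsub>G\<^esub> k), k) = y"
          using a_mult a_one y(2) kG by simp
        ultimately show "y \<in> ?m ` W" by (metis image_eqI)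
      qed
      ultimately show "\<exists>U. openin X U \<and> x \<in> U \<and> U \<subseteq> ?m ` W" by blast
    qed
    moreover have "?m ` W \<subseteq> T"
      using openin_subset[OF W] S ST inv top by auto
    ultimately show "openin (subtopology X T) (?m ` W)"
      using T by (simp add: openin_open_subtopology)
  qed
  have m_cont: "continuous_map (prod_topology S \<tau>) (subtopology X T) ?m"
  proof -
    have "continuous_map (prod_topology S \<tau>) X ?m"
      unfolding S_def prod_topology_subtopology by (rule continuous_map_from_subtopology[OF a_cont])
    then show ?thesis using S ST inv top by (auto simp: continuous_map_in_subtopology)
  qed
  have m_surj: "?m ` topspace (prod_topology S \<tau>) = topspace (subtopology X T)"
  proof
    show "?m ` topspace (prod_topology S \<tau>) \<subseteq> topspace (subtopology X T)"
      using S ST inv top TX by auto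
    show "topspace (subtopology X T) \<subseteq> ?m ` topspace (prod_topology S \<tau>)"
    proof
      fix x assume "x \<in> topspace (subtopology X T)"
      then have x: "x \<in> T" by simp
      then obtain g where g: "g \<in> carrier G" "p x = K #>\<^bsub>G\<^esub> g" using p_ex by blast
      have "?m (a x (inv\<^bsub>G\<^esub> g), g) = x" using a_mult a_one x g by simp
      moreover have "(a x (inv\<^bsub>G\<^esub> g), g) \<in> topspace (prod_topology S \<tau>)"
        using S_back[OF x g] g top S by simp
      ultimately show "x \<in> ?m ` topspace (prod_topology S \<tau>)" by (metis image_eqI)
    qed
  qed
  have m_quot: "quotient_map (prod_topology S \<tau>) (subtopology X T) ?m"
    using continuous_open_quotient_map[OF m_cont m_open] m_surj by blast
  have "quotient_map (prod_topology S \<tau>) ?B (\<lambda>z. ?R `` {z})"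
    unfolding balanced_product_def by (rule quotient_map_quotient_topology)
  then have "quotient_map (prod_topology S \<tau>) ?B (f \<circ> ?m)"
    by (rule quotient_map_eq) (use f S top in auto)
  then have "quotient_map (subtopology X T) ?B f"
    using quotient_map_compose_eq[OF m_quot] by blast
  moreover have "inj_on f (topspace (subtopology X T))"
  proof (rule inj_onI)
    fix x y assume "x \<in> topspace (subtopology X T)" and eq: "f x = f y"
    then have "x \<in> ?m ` topspace (prod_topology S \<tau>)" by (simp only: m_surj)
    then obtain s g where "s \<in> S\<^sub>0" "g \<in> carrier G" "x = a s g"
      using S top by (elim imageE) auto
    then have "(s, g) \<in> f x" by (simp add: f_def)
    then have "(s, g) \<in> f y" using eq by simp
    then show "x = y" using \<open>x = a s g\<close> by (simp add: f_def)
  qed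
  ultimately have "homeomorphic_map (subtopology X T) ?B f"
    by (simp add: homeomorphic_map_def)
  moreover have "equivariant G (subtopology X T) a (balanced_act G) f"
    unfolding equivariant_def
  proof (intro ballI equalityI subsetI)
    fix x k z assume "x \<in> topspace (subtopology X T)" and k: "k \<in> carrier G"
      and "z \<in> f (a x k)"
    then obtain s g where x: "x \<in> T" and z: "z = (s, g)"
      and s: "s \<in> S\<^sub>0" and g: "g \<in> carrier G" and eq: "a s g = a x k"
      by (auto simp: f_def)
    have "a s (g \<otimes>\<^bsub>G\<^esub> inv\<^bsub>G\<^esub> k) = x"
      using a_mult[of s g "inv\<^bsub>G\<^esub> k"] a_mult[of x k "inv\<^bsub>G\<^esub> k"] a_one[OF x] eq s ST g k x by simp
    then have "(s, g \<otimes>\<^bsub>G\<^esub> inv\<^bsub>G\<^esub> k) \<in> f x" using s g k by (simp add: f_def)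
    moreover have "z = (\<lambda>(s, g). (s, g \<otimes>\<^bsub>G\<^esub> k)) (s, g \<otimes>\<^bsub>G\<^esub> inv\<^bsub>G\<^esub> k)"
      using z g k by (simp add: m_assoc)
    ultimately show "z \<in> balanced_act G (f x) k"
      unfolding balanced_act_def by (rule rev_image_eqI)
  next
    fix x k z assume "x \<in> topspace (subtopology X T)" and k: "k \<in> carrier G"
      and "z \<in> balanced_act G (f x) k"
    then obtain s g where "x \<in> T" and "z = (s, g \<otimes>\<^bsub>G\<^esub> k)"
      and "s \<in> S\<^sub>0" and "g \<in> carrier G" and "a s g = x"
      by (auto simp: f_def balanced_act_def)
    then show "z \<in> f (a x k)" using a_mult[of s g k] ST k by (simp add: f_def)
  qed
  ultimately show ?thesis
    unfolding tube_def using T inv KF S_space by blast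
qed

section \<open>Finality\<close>

lemma continuous_map_extend_to_indiscrete_cone:
  assumes T: "openin X T" and p: "continuous_map (subtopology X T) A p"
  shows "continuous_map X (indiscrete_cone A) (\<lambda>x. if x \<in> T then Some (p x) else None)"
  unfolding continuous_map_indiscrete_cone
proof (intro conjI allI impI)
  have TX: "T \<subseteq> topspace X" using T by (rule openin_subset)
  show "(\<lambda>x. if x \<in> T then Some (p x) else None) \<in> topspace X \<rightarrow> insert None (Some ` topspace A)"
    using continuous_map_funspace[OF p] by (auto simp: Pi_iff)
  fix V assume "openin A V"
  from openin_continuous_map_preimage[OF p this]
  have "openin X {x \<in> T. p x \<in> V}"
    using T TX by (simp add: openin_open_subtopology Int_absorb1)
  moreover have "{x \<in> topspace X. (if x \<in> T then Some (p x) else None) \<in> Some ` V} = {x \<in> T. p x \<in> V}"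
    using TX by auto
  ultimately show "openin X {x \<in> topspace X. (if x \<in> T then Some (p x) else None) \<in> Some ` V}"
    by simp
qed

lemma G_map_to_E_space_exists:
  fixes X :: "'x topology" and I :: "'i set"
  assumes G: "topological_group G \<tau>" and F: "\<And>H. H \<in> F \<Longrightarrow> subgroup H G"
    and X: "tube_covered_space G \<tau> F I X a"
  shows "\<exists>f. G_map G X a (E_space G \<tau> F I) (E_act G I) f"
proof -
  interpret group G using G by (rule topological_group_imp_group)
  let ?A = "cosets_sum G \<tau> F"
  have sp: "right_space G \<tau> X a" using X by (simp add: tube_covered_space_def)
  obtain T where T: "\<And>i. i \<in> I \<Longrightarrow> tube G \<tau> F X a (T i)" and cov: "topspace X = (\<Union>i\<in>I. T i)"
    using X by (auto simp: tube_covered_space_def covered_by_tubes_def)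
  have "\<exists>H p. H \<in> F \<and> continuous_map (subtopology X (T i)) (coset_space G \<tau> H) p \<and>
    (\<forall>x\<in>T i. \<forall>g\<in>carrier G. p (a x g) = p x #>\<^bsub>G\<^esub> g)" if "i \<in> I" for i
    using tube_imp_map_to_coset_space[OF G F T[OF that]] by blast
  then obtain H p where H: "\<And>i. i \<in> I \<Longrightarrow> H i \<in> F"
    and p: "\<And>i. i \<in> I \<Longrightarrow> continuous_map (subtopology X (T i)) (coset_space G \<tau> (H i)) (p i)"
    and p_eq: "\<And>i x g. i \<in> I \<Longrightarrow> x \<in> T i \<Longrightarrow> g \<in> carrier G \<Longrightarrow> p i (a x g) = p i x #>\<^bsub>G\<^esub> g"
    by metis
  have T_inv: "a x g \<in> T i \<longleftrightarrow> x \<in> T i" if i: "i \<in> I" and x: "x \<in> topspace X" and g: "g \<in> carrier G"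
    for i x g
  proof
    assume "a x g \<in> T i"
    then have "a (a x g) (inv\<^bsub>G\<^esub> g) \<in> T i" using T[OF i] g unfolding tube_def by blast
    then show "x \<in> T i" using sp x g by (simp add: right_space_def)
  next
    assume "x \<in> T i"
    then show "a x g \<in> T i" using T[OF i] g unfolding tube_def by blast
  qed
  define f where "f x = (\<lambda>i\<in>I. if x \<in> T i then Some (H i, p i x) else None)" for x
  have "continuous_map X (E_space G \<tau> F I) f"
    unfolding continuous_map_E_space
  proof (intro conjI ballI)
    show "f \<in> topspace X \<rightarrow> extensional I" by (simp add: f_def)
    show "\<exists>i\<in>I. f x i \<noteq> None" if "x \<in> topspace X" for x
      using that cov by (auto simp: f_def)
    fix i assume i: "i \<in> I"
    have "continuous_map (subtopology X (T i)) ?A (Pair (H i) \<circ> p i)"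
      unfolding cosets_sum_def
      by (rule continuous_map_compose[OF p[OF i]])
        (rule continuous_map_component_injection[OF H[OF i], where X = "coset_space G \<tau>"])
    then have "continuous_map X (indiscrete_cone ?A)
        (\<lambda>x. if x \<in> T i then Some ((Pair (H i) \<circ> p i) x) else None)"
      using T[OF i] unfolding tube_def
      by (intro continuous_map_extend_to_indiscrete_cone) blast
    then show "continuous_map X (indiscrete_cone ?A) (\<lambda>x. f x i)"
      using i by (simp add: f_def cong: if_cong)
  qed
  moreover have "equivariant G X a (E_act G I) f"
    unfolding equivariant_def
  proof (intro ballI)
    fix x g assume x: "x \<in> topspace X" and g: "g \<in> carrier G"
    show "f (a x g) = E_act G I (f x) g"
    proof (rule extensionalityI[where A = I])
      show "f (a x g) i = E_act G I (f x) g i" if i: "i \<in> I" for i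
        using i T_inv[OF i x g] p_eq[OF i _ g]
        by (simp add: f_def E_act_def cone_act_def cosets_sum_act_def)
    qed (simp_all add: f_def E_act_def)
  qed
  ultimately show ?thesis unfolding G_map_def by blast
qed

text \<open>The relation of \<open>G\<close>-homotopy is all of \<open>M \<times> M\<close> for the set \<open>M\<close> of \<open>G\<close>-maps, so \<open>M\<close> itself is the
  only class.\<close>

lemma unique_morphisms_to_E_space:
  fixes G :: "('g, 'm) monoid_scheme" and I :: "'i set"
  assumes G: "topological_group G \<tau>" and F: "\<And>H. H \<in> F \<Longrightarrow> subgroup H G" and I: "infinite I"
  shows "unique_morphisms_to TYPE('x) G \<tau> F I (E_space G \<tau> F I) (E_act G I)"
  unfolding unique_morphisms_to_def
proof (intro allI impI)
  fix X :: "'x topology" and a assume X: "tube_covered_space G \<tau> F I X a"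
  let ?E = "E_space G \<tau> F I" and ?b = "E_act G I"
  let ?M = "G_maps G X a ?E ?b"
  have sp: "right_space G \<tau> X a" using X by (simp add: tube_covered_space_def)
  obtain f where f: "G_map G X a ?E ?b f" using G_map_to_E_space_exists[OF G F X] by blast
  have "restrict f (topspace X) \<in> ?M"
    using f right_space_closed[OF sp] topspace_topological_group[OF G]
    by (auto simp: G_maps_def G_map_def equivariant_def intro: continuous_map_eq)
  moreover have "G_homotopic G X a ?E ?b f f'" if "f \<in> ?M" "f' \<in> ?M" for f f'
    using G_homotopic_E_space[OF I, of G X a \<tau> F "\<lambda>b. if b then f' else f"] that
    by (simp add: G_maps_def)
  then have "{(f, f'). f \<in> ?M \<and> f' \<in> ?M \<and> G_homotopic G X a ?E ?b f f'} = ?M \<times> ?M"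
    by auto
  ultimately have "G_homotopy_classes G X a ?E ?b = {?M}"
    by (auto simp: G_homotopy_classes_def quotient_def)
  then show "\<exists>!c. c \<in> G_homotopy_classes G X a ?E ?b" by simp
qed

lemma tube_covered_E_space:
  fixes G :: "('g, 'm) monoid_scheme" and I :: "'i set"
  assumes G: "topological_group G \<tau>" and F: "\<And>H. H \<in> F \<Longrightarrow> subgroup H G" and I: "infinite I"
    and dom: "dominated G F I"
  shows "tube_covered_space G \<tau> F I (E_space G \<tau> F I) (E_act G I)"
proof -
  interpret group G using G by (rule topological_group_imp_group)
  let ?E = "E_space G \<tau> F I" and ?A = "cosets_sum G \<tau> F"
  have sp: "right_space G \<tau> ?E (E_act G I)" by (rule right_space_E_space[OF G F])
  obtain F' where F': "F' \<subseteq> F" "F' \<noteq> {}" "F' \<lesssim> I"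
    and "\<forall>H\<in>F. \<exists>K\<in>F'. \<exists>g\<in>carrier G. \<forall>h\<in>H. g \<otimes>\<^bsub>G\<^esub> h \<otimes>\<^bsub>G\<^esub> inv\<^bsub>G\<^esub> g \<in> K"
    using dom unfolding dominated_def by (elim exE conjE)
  then obtain \<kappa> \<gamma> where \<kappa>: "\<And>H. H \<in> F \<Longrightarrow> \<kappa> H \<in> F'" and \<gamma>: "\<And>H. H \<in> F \<Longrightarrow> \<gamma> H \<in> carrier G"
    and \<gamma>\<kappa>: "\<And>H h. H \<in> F \<Longrightarrow> h \<in> H \<Longrightarrow> \<gamma> H \<otimes>\<^bsub>G\<^esub> h \<otimes>\<^bsub>G\<^esub> inv\<^bsub>G\<^esub> (\<gamma> H) \<in> \<kappa> H"
    by metis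
  have \<kappa>F: "\<kappa> H \<in> F" if "H \<in> F" for H using \<kappa>[OF that] F' by blast
  \<comment> \<open>The map \<open>H\G \<rightarrow> K\G\<close>, \<open>Hx \<mapsto> K\<gamma>x\<close>, for the \<open>K = \<kappa> H\<close> to which \<open>H\<close> is assigned.\<close>
  define r where "r H C = \<kappa> H #>\<^bsub>G\<^esub> (\<gamma> H \<otimes>\<^bsub>G\<^esub> (SOME c. c \<in> C))" for H C
  have r: "r H (H #>\<^bsub>G\<^esub> x) = \<kappa> H #>\<^bsub>G\<^esub> (\<gamma> H \<otimes>\<^bsub>G\<^esub> x)" if H: "H \<in> F" and x: "x \<in> carrier G" for H x
  proof -
    have "(SOME c. c \<in> H #>\<^bsub>G\<^esub> x) \<in> H #>\<^bsub>G\<^esub> x"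
      using rcos_self[OF x F[OF H]] by (rule someI)
    then obtain h where h: "h \<in> H" "(SOME c. c \<in> H #>\<^bsub>G\<^esub> x) = h \<otimes>\<^bsub>G\<^esub> x"
      by (auto simp: r_coset_def)
    have hG: "h \<in> carrier G" using F[OF H] h(1) by (rule subgroup.mem_carrier)
    have "\<gamma> H \<otimes>\<^bsub>G\<^esub> (h \<otimes>\<^bsub>G\<^esub> x) = (\<gamma> H \<otimes>\<^bsub>G\<^esub> h \<otimes>\<^bsub>G\<^esub> inv\<^bsub>G\<^esub> (\<gamma> H)) \<otimes>\<^bsub>G\<^esub> (\<gamma> H \<otimes>\<^bsub>G\<^esub> x)"
      using \<gamma>[OF H] hG x by (simp add: m_assoc inv_solve_left)
    then show ?thesis
      unfolding r_def h(2)
      using \<gamma>\<kappa>[OF H h(1)] \<gamma>[OF H] hG x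
        rcos_eq_iff[OF is_group F[OF \<kappa>F[OF H]], of "\<gamma> H \<otimes>\<^bsub>G\<^esub> (h \<otimes>\<^bsub>G\<^esub> x)" "\<gamma> H \<otimes>\<^bsub>G\<^esub> x"]
      by auto
  qed
  \<comment> \<open>The preimage of \<open>V \<subseteq> K\G\<close> under \<open>r\<close>. For \<open>V = UNIV\<close> it is the part of \<open>F\G\<close> that lies over \<open>K\G\<close>.\<close>
  define P where "P K V = {(H, H #>\<^bsub>G\<^esub> x) | H x.
    H \<in> F \<and> x \<in> carrier G \<and> \<kappa> H = K \<and> r H (H #>\<^bsub>G\<^esub> x) \<in> V}" for K V
  have P_open: "openin ?A (P K V)" if V: "openin (coset_space G \<tau> K) V" for K V
  proof -
    have "openin \<tau> {x \<in> carrier G. (H, H #>\<^bsub>G\<^esub> x) \<in> P K V}" if H: "H \<in> F" for H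
    proof (cases "\<kappa> H = K")
      case True
      have "openin \<tau> {x \<in> carrier G. K #>\<^bsub>G\<^esub> x \<in> V}"
        using V by (simp add: coset_space_def openin_quotient_topology topspace_topological_group[OF G])
      from openin_continuous_map_preimage[OF continuous_map_left_translation[OF G \<gamma>[OF H]] this]
      have "openin \<tau> {x \<in> carrier G. K #>\<^bsub>G\<^esub> (\<gamma> H \<otimes>\<^bsub>G\<^esub> x) \<in> V}"
        using \<gamma>[OF H] by (simp add: topspace_topological_group[OF G] cong: conj_cong)
      moreover have "(H, H #>\<^bsub>G\<^esub> x) \<in> P K V \<longleftrightarrow> K #>\<^bsub>G\<^esub> (\<gamma> H \<otimes>\<^bsub>G\<^esub> x) \<in> V"
        if x: "x \<in> carrier G" for x
      proof -
        have "(H, H #>\<^bsub>G\<^esub> x) \<in> P K V \<longleftrightarrow> r H (H #>\<^bsub>G\<^esub> x) \<in> V"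
          using x H True unfolding P_def by auto
        then show ?thesis using r[OF H x] True by simp
      qed
      ultimately show ?thesis by (simp cong: conj_cong)
    next
      case False
      then have "{x \<in> carrier G. (H, H #>\<^bsub>G\<^esub> x) \<in> P K V} = {}" by (auto simp: P_def)
      then show ?thesis by (simp only: openin_empty)
    qed
    moreover have "P K V \<subseteq> {(H, H #>\<^bsub>G\<^esub> x) | H x. H \<in> F \<and> x \<in> carrier G}"
      unfolding P_def by blast
    ultimately show ?thesis by (simp add: openin_cosets_sum[OF G])
  qed
  define T where "T i K = {e \<in> topspace ?E. e i \<in> Some ` P K UNIV}" for i K
  define q where "q i e = (case e i of Some (H, C) \<Rightarrow> r H C)" for i and e :: "'i \<Rightarrow> ('g set \<times> 'g set) option"
  have T_tube: "tube G \<tau> F ?E (E_act G I) (T i K)" if i: "i \<in> I" and K: "K \<in> F'" for i K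
  proof -
    note KG = F[OF subsetD[OF F'(1) K]]
    have T_elim: "\<exists>H x. H \<in> F \<and> x \<in> carrier G \<and> \<kappa> H = K \<and> e i = Some (H, H #>\<^bsub>G\<^esub> x) \<and> e \<in> topspace ?E"
      if "e \<in> T i K" for e
      using that by (auto simp: T_def P_def)
    have TI: "e \<in> T i K" if "e \<in> topspace ?E" "e i = Some (H, H #>\<^bsub>G\<^esub> x)" "H \<in> F" "x \<in> carrier G" "\<kappa> H = K"
      for e H x
      using that by (auto simp: T_def P_def)
    have q: "q i e = K #>\<^bsub>G\<^esub> (\<gamma> H \<otimes>\<^bsub>G\<^esub> x)"
      if "e i = Some (H, H #>\<^bsub>G\<^esub> x)" "H \<in> F" "x \<in> carrier G" "\<kappa> H = K" for e H x
      using that by (simp add: q_def r)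
    have r_coset: "K #>\<^bsub>G\<^esub> x \<in> topspace (coset_space G \<tau> K)" if "x \<in> carrier G" for x
      using that by (simp add: coset_space_def topspace_quotient_topology topspace_topological_group[OF G])
    have preimage: "openin ?E {e \<in> T i K. q i e \<in> V}" if V: "openin (coset_space G \<tau> K) V" for V
    proof -
      have "(H, C) \<in> P K V \<longleftrightarrow> (H, C) \<in> P K UNIV \<and> r H C \<in> V" for H C
        by (auto simp: P_def)
      then have eq: "{e \<in> T i K. q i e \<in> V} = {e \<in> topspace ?E. e i \<in> Some ` P K V}"
        by (auto simp: T_def q_def image_iff)
      have "continuous_map ?E (indiscrete_cone ?A) (\<lambda>e. e i)"
        by (rule continuous_map_E_space_component[OF i])
      then show ?thesis
        using P_open[OF V] unfolding eq continuous_map_indiscrete_cone by blast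
    qed
    have q_mem: "q i e \<in> topspace (coset_space G \<tau> K)" if e: "e \<in> T i K" for e
    proof -
      obtain H x where "H \<in> F" "x \<in> carrier G" "\<kappa> H = K" "e i = Some (H, H #>\<^bsub>G\<^esub> x)"
        using T_elim[OF e] by blast
      then show ?thesis using q r_coset \<gamma> by simp
    qed
    have T_open: "openin ?E (T i K)"
    proof -
      have "{e \<in> T i K. q i e \<in> topspace (coset_space G \<tau> K)} = T i K" using q_mem by blast
      then show ?thesis using preimage[OF openin_topspace] by simp
    qed
    have act: "E_act G I e g \<in> T i K \<and> q i (E_act G I e g) = q i e #>\<^bsub>G\<^esub> g"
      if e: "e \<in> T i K" and g: "g \<in> carrier G" for e g
    proof -
      obtain H x where H: "H \<in> F" "\<kappa> H = K" and x: "x \<in> carrier G"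
        and ei: "e i = Some (H, H #>\<^bsub>G\<^esub> x)" and eE: "e \<in> topspace ?E"
        using T_elim[OF e] by blast
      have ai: "E_act G I e g i = Some (H, H #>\<^bsub>G\<^esub> (x \<otimes>\<^bsub>G\<^esub> g))"
        using i ei rcos_translate[OF is_group F[OF H(1)] x g]
        by (simp add: E_act_def cone_act_def cosets_sum_act_def)
      have aE: "E_act G I e g \<in> topspace ?E"
        using right_space_closed[OF sp eE] g topspace_topological_group[OF G] by simp
      have xg: "x \<otimes>\<^bsub>G\<^esub> g \<in> carrier G" using x g by simp
      have "q i (E_act G I e g) = K #>\<^bsub>G\<^esub> (\<gamma> H \<otimes>\<^bsub>G\<^esub> (x \<otimes>\<^bsub>G\<^esub> g))" by (rule q) fact+
      moreover have "q i e = K #>\<^bsub>G\<^esub> (\<gamma> H \<otimes>\<^bsub>G\<^esub> x)" by (rule q) fact+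
      ultimately have "q i (E_act G I e g) = q i e #>\<^bsub>G\<^esub> g"
        using x g \<gamma>[OF H(1)] rcos_translate[OF is_group KG, of "\<gamma> H \<otimes>\<^bsub>G\<^esub> x" g]
        by (simp add: m_assoc)
      moreover have "E_act G I e g \<in> T i K" by (rule TI) fact+
      ultimately show ?thesis by simp
    qed
    have "continuous_map (subtopology ?E (T i K)) (coset_space G \<tau> K) (q i)"
      using q_mem preimage T_open openin_subset[OF T_open]
      by (auto simp: continuous_map_def openin_open_subtopology Int_absorb1)
    then show ?thesis
      using act by (intro tube_if_map_to_coset_space[OF G sp subsetD[OF F'(1) K] KG T_open]) auto
  qed
  have T_cover: "\<exists>i\<in>I. \<exists>K\<in>F'. e \<in> T i K" if e: "e \<in> topspace ?E" for e
  proof -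
    obtain i z where i: "i \<in> I" and z: "e i = Some z"
      using e unfolding topspace_E_space by blast
    have "e i \<in> insert None (Some ` topspace ?A)"
      using e i unfolding topspace_E_space by (blast dest: PiE_mem)
    then have "z \<in> topspace ?A" using z by auto
    then obtain H x where "H \<in> F" "x \<in> carrier G" "e i = Some (H, H #>\<^bsub>G\<^esub> x)"
      using z unfolding topspace_cosets_sum[OF G] by blast
    then have "e \<in> T i (\<kappa> H)" using e by (auto simp: T_def P_def)
    then show ?thesis using i \<kappa>[OF \<open>H \<in> F\<close>] by blast
  qed
  have "I \<times> F' \<approx> I" by (rule Times_eqpoll_infinite[OF I F'(2,3)])
  then obtain \<beta> where \<beta>: "bij_betw \<beta> I (I \<times> F')" using eqpoll_sym eqpoll_def by blast
  have "tube G \<tau> F ?E (E_act G I) (case_prod T (\<beta> i))" if "i \<in> I" for i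
    using T_tube bij_betwE[OF \<beta>] that by fastforce
  moreover have "topspace ?E = (\<Union>i\<in>I. case_prod T (\<beta> i))"
  proof -
    have "(\<Union>i\<in>I. case_prod T (\<beta> i)) = (\<Union>z\<in>I \<times> F'. case_prod T z)"
      using bij_betw_imp_surj_on[OF \<beta>] by (metis image_image)
    also have "\<dots> = topspace ?E" using T_cover by (auto simp: T_def)
    finally show ?thesis by simp
  qed
  ultimately have "covered_by_tubes G \<tau> F I ?E (E_act G I)"
    unfolding covered_by_tubes_def by (intro exI[of _ "\<lambda>i. case_prod T (\<beta> i)"]) simp
  then show ?thesis using sp by (simp add: tube_covered_space_def)
qed

theorem theorem3p11:
  fixes G :: "('g, 'm) monoid_scheme" and \<tau> :: "'g topology"
    and F :: "'g set set" and I :: "'i set"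
  assumes "topological_group G \<tau>"
    and "\<And>H. H \<in> F \<Longrightarrow> subgroup H G"
    and "infinite I"
  shows "unique_morphisms_to TYPE('x) G \<tau> F I (E_space G \<tau> F I) (E_act G I) \<and>
    (dominated G F I \<longrightarrow> final_object TYPE('x) G \<tau> F I (E_space G \<tau> F I) (E_act G I))"
proof (intro conjI impI)
  show *: "unique_morphisms_to TYPE('x) G \<tau> F I (E_space G \<tau> F I) (E_act G I)"
    by (rule unique_morphisms_to_E_space) fact+
  assume "dominated G F I"
  with assms have "tube_covered_space G \<tau> F I (E_space G \<tau> F I) (E_act G I)"
    by (intro tube_covered_E_space)
  then show "final_object TYPE('x) G \<tau> F I (E_space G \<tau> F I) (E_act G I)"
    using * by (simp add: final_object_def)
qed

end
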